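(* Let $\mathcal C$ be a class of permutations (of sets $\{1,\dots,n\}$, $n\ge 0$) that is closed under trivial reductions and trivial extensions. Let $p(n,k)$ be the number of permutations of $\{1,\dots,n\}$ in $\mathcal C$ with $k$ cycles and $r(n,k)$ the number of reduced permutations of $\{1,\dots,n\}$ in $\mathcal C$ with $k$ cycles, and set $P(x,y)=\sum_{n,k}p(n,k)x^ny^k$, $R(x,y)=\sum_{n,k}r(n,k)x^ny^k$. Then $$P(x,y)=R\bigl(x\,D(x,y),y\bigr)\cdot\left(1+x\cdot\frac{\frac{\partial}{\partial x}D(x,y)}{D(x,y)}\right),$$ where $$D(x,y)=\frac{1-x-xy-\sqrt{(x+xy-1)^2-4x^2y}}{2x}+1 .$$
   Context: A trivial cycle of a permutation $\pi$ of $\{1,\dots,n\}$ is a cycle of the form $(i,i+1,\dots,i+p)$ with entries taken modulo $n$ (so it consists of cyclically consecutive points; it may contain $n$ followed by $1$, and a fixed point is a trivial cycle). A permutation is reduced if it has no trivial cycle; by convention the empty permutation of the empty set is reduced. A trivial reduction of $\pi$ is the permutation obtained by deleting one trivial cycle from the cycle decomposition of $\pi$ and relabeling the remaining elements by $1,\dots,n'$ preserving their relative order; $\pi$ is then called a trivial extension of the result. $D(x,y)$ is the formal power series solution of $D=1+xyD+x(D-1)D$; its coefficient of $x^ny^k$ is the number of noncrossing partitions of $\{1,\dots,n\}$ with $k$ parts (constant term $1$).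
   Formalization: The formula as stated fails when C contains the empty permutation (e.g. all permutations, at x^2); it is proved when C does not contain it, and otherwise in the corrected form P = (R-1)(xD,y)(1 + x D_x/D) + D. *)

theory Defs
  imports
    "HOL-Combinatorics.Orbits"
    "HOL-Combinatorics.Cycles"
    "HOL-Computational_Algebra.Formal_Power_Series"
begin

text \<open>
  A permutation of \<open>{1..n}\<close> is a pair \<open>(n, \<pi>)\<close> with \<open>\<pi> permutes {1..n}\<close>. The size has to be
  recorded, because \<open>\<pi>\<close> alone does not determine it: \<open>id\<close> permutes every \<open>{1..n}\<close>.
  The empty permutation is \<open>(0, id)\<close>. It needs separate treatment: a reduced permutation of size
  \<open>n \<ge> 1\<close> is extended by inserting noncrossing partitions in the \<open>n\<close> gaps of a circle, which
  gives \<open>(x D)\<^sup>n (1 + x D\<^sub>x / D)\<close>, whereas the permutations that reduce to the empty one are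
  the noncrossing partitions themselves, counted by \<open>D\<close> and not by \<open>1 + x D\<^sub>x / D\<close>.
\<close>

type_synonym sized_perm = "nat \<times> (nat \<Rightarrow> nat)"

text \<open>Fixed points count as cycles.\<close>

definition num_cycles :: "nat \<Rightarrow> (nat \<Rightarrow> nat) \<Rightarrow> nat" where
  "num_cycles n \<pi> = card (orbit \<pi> ` {1..n})"

text \<open>
  The list \<open>cs\<close> is \<open>[i, i + 1, \<dots>, i + p]\<close> with entries taken modulo \<open>n\<close> in \<open>{1..n}\<close>. The bound
  \<open>p < n\<close> makes these entries distinct, so that \<^const>\<open>cycle_of_list\<close> is meaningful.
\<close>

definition trivial_cycle :: "nat \<Rightarrow> (nat \<Rightarrow> nat) \<Rightarrow> nat list \<Rightarrow> bool" where
  "trivial_cycle n \<pi> cs \<longleftrightarrow>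
     (\<exists>i\<in>{1..n}. \<exists>p<n. cs = map (\<lambda>j. (i - 1 + j) mod n + 1) [0..<Suc p]) \<and>
     (\<forall>a\<in>set cs. \<pi> a = cycle_of_list cs a)"

definition reduced_perm :: "nat \<Rightarrow> (nat \<Rightarrow> nat) \<Rightarrow> bool" where
  "reduced_perm n \<pi> \<longleftrightarrow> \<pi> permutes {1..n} \<and> (\<nexists>cs. trivial_cycle n \<pi> cs)"

text \<open>
  \<open>(n', \<pi>')\<close> is a trivial reduction of \<open>(n, \<pi>)\<close>; equivalently \<open>(n, \<pi>)\<close> is a trivial extension of
  \<open>(n', \<pi>')\<close>. The map \<open>f\<close> is the inverse of the order-preserving relabeling.
\<close>

definition trivial_reduction :: "sized_perm \<Rightarrow> sized_perm \<Rightarrow> bool" where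
  "trivial_reduction = (\<lambda>(n, \<pi>) (n', \<pi>').
     \<pi> permutes {1..n} \<and> \<pi>' permutes {1..n'} \<and>
     (\<exists>cs f. trivial_cycle n \<pi> cs \<and>
        bij_betw f {1..n'} ({1..n} - set cs) \<and> strict_mono_on {1..n'} f \<and>
        (\<forall>i\<in>{1..n'}. f (\<pi>' i) = \<pi> (f i))))"

definition perm_class :: "sized_perm set \<Rightarrow> bool" where
  "perm_class C \<longleftrightarrow> (\<forall>(n, \<pi>)\<in>C. \<pi> permutes {1..n})"

definition closed_under_trivial_reductions :: "sized_perm set \<Rightarrow> bool" where
  "closed_under_trivial_reductions C \<longleftrightarrow>
     (\<forall>\<sigma>\<in>C. \<forall>\<tau>. trivial_reduction \<sigma> \<tau> \<longrightarrow> \<tau> \<in> C)"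

definition closed_under_trivial_extensions :: "sized_perm set \<Rightarrow> bool" where
  "closed_under_trivial_extensions C \<longleftrightarrow>
     (\<forall>\<tau>\<in>C. \<forall>\<sigma>. trivial_reduction \<sigma> \<tau> \<longrightarrow> \<sigma> \<in> C)"

definition num_perms :: "sized_perm set \<Rightarrow> nat \<Rightarrow> nat \<Rightarrow> nat" where
  "num_perms C n k = card {\<pi>. (n, \<pi>) \<in> C \<and> num_cycles n \<pi> = k}"

definition num_reduced_perms :: "sized_perm set \<Rightarrow> nat \<Rightarrow> nat \<Rightarrow> nat" where
  "num_reduced_perms C n k =
     card {\<pi>. (n, \<pi>) \<in> C \<and> reduced_perm n \<pi> \<and> num_cycles n \<pi> = k}"

text \<open>
  Power series in \<open>x\<close> and \<open>y\<close> are power series in \<open>x\<close> over the ring of power series in \<open>y\<close>. Thus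
  \<^const>\<open>fps_deriv\<close> is \<open>\<partial>/\<partial>x\<close>, and \<^const>\<open>fps_compose\<close> substitutes for \<open>x\<close>, leaving \<open>y\<close> alone.
\<close>

type_synonym fps2 = "real fps fps"

abbreviation X :: fps2 where "X \<equiv> fps_X"
abbreviation Y :: fps2 where "Y \<equiv> fps_const fps_X"

definition gf2 :: "(nat \<Rightarrow> nat \<Rightarrow> nat) \<Rightarrow> fps2" where
  "gf2 a = Abs_fps (\<lambda>n. Abs_fps (\<lambda>k. real (a n k)))"

abbreviation perm_gf :: "sized_perm set \<Rightarrow> fps2" where
  "perm_gf C \<equiv> gf2 (num_perms C)"

abbreviation reduced_perm_gf :: "sized_perm set \<Rightarrow> fps2" where
  "reduced_perm_gf C \<equiv> gf2 (num_reduced_perms C)"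

definition nc_gf :: fps2 where
  "nc_gf = (THE D. D = 1 + X * Y * D + X * (D - 1) * D)"

text \<open>
  The library's \<^const>\<open>fps_radical\<close> needs a field of coefficients, which the power series in \<open>y\<close>
  are not.
\<close>

definition fps_sqrt :: "'a::idom fps \<Rightarrow> 'a fps" where
  "fps_sqrt f = (THE g. g\<^sup>2 = f \<and> fps_nth g 0 = 1)"

text \<open>The two definite descriptions above are well-defined.\<close>

fun nc_coeff :: "nat \<Rightarrow> real fps" where
  "nc_coeff 0 = 1"
| "nc_coeff (Suc n) = fps_X * nc_coeff n +
     (\<Sum>i\<le>n. (nc_coeff i - (if i = 0 then 1 else 0)) * nc_coeff (n - i))"

lemma nat_all_0_Suc: "(\<forall>n. P n) \<longleftrightarrow> P 0 \<and> (\<forall>n. P (Suc n))"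
  by (metis not0_implies_Suc)

lemma nc_gf_ex1: "\<exists>!D::fps2. D = 1 + X * Y * D + X * (D - 1) * D"
proof -
  have rec: "D = 1 + X * Y * D + X * (D - 1) * D \<longleftrightarrow>
      fps_nth D 0 = 1 \<and>
      (\<forall>n. fps_nth D (Suc n) = fps_X * fps_nth D n +
        (\<Sum>i\<le>n. (fps_nth D i - (if i = 0 then 1 else 0)) * fps_nth D (n - i)))" for D :: fps2
  proof -
    have "D = 1 + X * Y * D + X * (D - 1) * D \<longleftrightarrow> D = 1 + X * (Y * D + (D - 1) * D)"
      by (simp add: algebra_simps)
    also have "\<dots> \<longleftrightarrow> (\<forall>n. fps_nth D n = fps_nth (1 + X * (Y * D + (D - 1) * D)) n)"
      by (simp add: fps_eq_iff)
    also have "\<dots> \<longleftrightarrow> fps_nth D 0 = 1 \<and>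
        (\<forall>n. fps_nth D (Suc n) = fps_nth (1 + X * (Y * D + (D - 1) * D)) (Suc n))"
      by (subst nat_all_0_Suc) simp
    finally show ?thesis
      by (simp add: fps_mult_nth[of "D - 1"] fps_one_nth atMost_atLeast0 del: fps_mult_nth_0)
  qed
  show ?thesis
  proof (rule ex1I[of _ "Abs_fps nc_coeff"])
    show "Abs_fps nc_coeff = 1 + X * Y * Abs_fps nc_coeff +
        X * (Abs_fps nc_coeff - 1) * Abs_fps nc_coeff"
      unfolding rec by simp
  next
    fix D :: fps2
    assume "D = 1 + X * Y * D + X * (D - 1) * D"
    then have D: "fps_nth D 0 = 1" "fps_nth D (Suc n) = fps_X * fps_nth D n +
        (\<Sum>i\<le>n. (fps_nth D i - (if i = 0 then 1 else 0)) * fps_nth D (n - i))" for n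
      unfolding rec by blast+
    have "fps_nth D n = nc_coeff n" for n
      by (induction n rule: nc_coeff.induct) (auto simp: D intro!: sum.cong)
    then show "D = Abs_fps nc_coeff"
      by (simp add: fps_eq_iff)
  qed
qed

lemma nc_gf_eq: "nc_gf = 1 + X * Y * nc_gf + X * (nc_gf - 1) * nc_gf"
  unfolding nc_gf_def by (rule theI'[OF nc_gf_ex1])

lemma fps_sqrt_eqI:
  fixes g :: "'a::idom fps"
  assumes "(2::'a) \<noteq> 0" "g\<^sup>2 = f" "fps_nth g 0 = 1"
  shows "fps_sqrt f = g"
  unfolding fps_sqrt_def
proof (rule the_equality)
  fix h assume h: "h\<^sup>2 = f \<and> fps_nth h 0 = 1"
  then have "h = g \<or> h = - g"
    using assms(2) by (metis power2_eq_iff)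
  moreover have "h \<noteq> - g"
  proof
    assume "h = - g"
    then have "(1::'a) = - 1"
      using h assms(3) by (metis fps_neg_nth)
    then have "(1::'a) + 1 = 0"
      by (metis add.left_inverse)
    with assms(1) show False by simp
  qed
  ultimately show "h = g" by blast
qed (use assms in simp)

lemma nc_gf_sqrt:
  "fps_sqrt ((X + X * Y - 1)\<^sup>2 - 4 * X\<^sup>2 * Y) = 1 - X - X * Y - 2 * X * (nc_gf - 1)"
proof (rule fps_sqrt_eqI)
  have "(1 - X - X * Y - 2 * X * (D - 1))\<^sup>2 - ((X + X * Y - 1)\<^sup>2 - 4 * X\<^sup>2 * Y) =
      4 * X * (1 + X * Y * D + X * (D - 1) * D - D)" for D :: fps2
    by (simp add: power2_eq_square algebra_simps)
  from this[of nc_gf] show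
    "(1 - X - X * Y - 2 * X * (nc_gf - 1))\<^sup>2 = (X + X * Y - 1)\<^sup>2 - 4 * X\<^sup>2 * Y"
    using nc_gf_eq by simp
qed simp_all

end

theory Submission
  imports Defs
begin

text \<open>
  No unique reduced core is needed: instead, count reduced permutations by inclusion-exclusion over sets
  of trivial cycles. A permutation of size \<open>n\<close> with a chosen set \<open>S\<close> of its trivial cycles, weighted by
  \<open>(-1)\<^bsup>|S|\<^esup>\<close>, amounts to the set \<open>K\<close> of points outside \<open>S\<close>, the ends of the arcs in \<open>S\<close>, and the
  permutation on \<open>K\<close>, which lies in the class as well by the closure properties. For \<open>K\<close> of size
  \<open>m \<ge> 1\<close>, rotating the circle shows that the arcs contribute \<open>n / m\<close> times the coefficient of \<open>x\<^sup>n\<close>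
  in \<open>\<phi>\<^sup>m\<close>, where \<open>\<phi> = x (1 - x) / (1 - (1 - y) x)\<close>. Hence, up to the contribution of \<open>K = {}\<close>,
  \<open>R = P(\<phi>) x \<phi>\<^sub>x / \<phi>\<close>. Since \<open>\<phi>\<close> is the compositional inverse of \<open>x D\<close>, substituting \<open>x D\<close> for
  \<open>x\<close> gives the formula for \<open>P\<close>.
\<close>

text \<open>The arcs in \<open>S\<close> are all cycles of the given permutation, so they are
  disjoint and never nested. This is why the gap series \<open>phi\<close> is rational although
  repeated reduction removes nested cycles; nesting enters only through the compositional inverse
  \<open>x D\<close>. The chosen arcs can be treated independently because deleting some trivial
  cycles leaves the other trivial cycles trivial, so that all of \<open>S\<close> can be deleted one
  by one inside the class, and conversely any permutation in the class may be filled in on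
  \<open>K\<close>. The obstacle is the circle. The factor \<open>n / m\<close> becomes an operation
  on series by dividing the coefficients of \<open>P\<close> by \<open>m\<close> and reading
  multiplication by \<open>n\<close> as \<open>x\<close> times a derivative; the chain rule then
  produces the derivative of \<open>phi\<close>. For \<open>K = {}\<close> there is no kept point at
  which to cut the circle open, and a full circle taken as one arc has no distinguished end. This
  case therefore has a series of its own, which is the origin of the separate formula for classes
  that contain the empty permutation.\<close>

declare One_nat_def [simp del]

subsection \<open>Power series\<close>

text \<open>Constant term 1 makes \<open>g\<close> a unit although the coefficients need not form a
  field. The class \<open>inverse\<close> carries no laws, hence the assumption on
  \<open>inverse 1\<close>.\<close>

lemma fps_divide_mult_cancel:
  fixes f g :: "'a::{idom,inverse} fps"
  assumes "fps_nth g 0 = 1" "inverse (1::'a) = 1"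
  shows "f / g * g = f"
proof -
  have "inverse g * g = 1"
    using fps_left_inverse'[of 1 g 1] assms by (simp add: fps_inverse_def)
  then show ?thesis
    using assms by (simp add: fps_divide_unit mult.assoc)
qed

abbreviation U :: fps2 where "U \<equiv> fps_const (1 - fps_X)"

text \<open>The series \<open>1 / (1 - (1 - y) x)\<close>, given by its coefficients so that no
  division occurs.\<close>

definition geo :: fps2 where "geo = Abs_fps (\<lambda>n. (1 - fps_X) ^ n)"

text \<open>
  The factor \<open>(1 - x) / (1 - (1 - y) x) = 1 / (1 + x y / (1 - x))\<close> counts the sequences of arcs
  that can follow a kept point, where an arc of length \<open>j\<close> has weight \<open>- y x\<^sup>j\<close>.
\<close>

definition phi :: fps2 where "phi = X * (1 - X) * geo"

lemma geo_eq: "geo * (1 - U * X) = 1"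
proof (rule fps_ext)
  fix n
  have "geo * (1 - U * X) = geo - X * (U * geo)"
    by (simp add: algebra_simps)
  then show "fps_nth (geo * (1 - U * X)) n = fps_nth 1 n"
    by (cases n) (simp_all add: geo_def)
qed

lemma phi_eq: "phi * (1 - U * X) = X * (1 - X)"
  using geo_eq by (simp add: phi_def mult.assoc)

lemma U_eq: "U = 1 - Y"
  by (metis fps_const_1_eq_1 fps_const_sub)

lemma phi_nth_0 [simp]: "fps_nth phi 0 = 0"
  by (simp add: phi_def mult.assoc)

lemma nc_gf_nth_0 [simp]: "fps_nth nc_gf 0 = 1"
  by (subst nc_gf_eq) (simp add: mult.assoc)

text \<open>With \<open>s = x D\<close>, multiplying by \<open>x\<close> gives
  \<open>s (1 - s) = x (1 - (1 - y) s)\<close>, which is \<open>phi_eq\<close> read at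
  \<open>s\<close>. In this form the functional equation says that \<open>x D\<close> inverts
  \<open>phi\<close>.\<close>

lemma nc_gf_eq': "nc_gf * (1 - X * nc_gf) = 1 - U * (X * nc_gf)"
proof -
  have "nc_gf * (1 - X * nc_gf) =
      (1 + X * Y * nc_gf + X * (nc_gf - 1) * nc_gf) - X * nc_gf * nc_gf"
    using nc_gf_eq by (simp add: algebra_simps)
  then show ?thesis by (simp add: U_eq algebra_simps)
qed

lemma fps_compose_one_minus: "(1 - a) oo b = 1 - (a oo b :: fps2)"
  by (simp add: fps_compose_sub_distrib)

lemma nc_nz: "nc_gf \<noteq> 0" "1 - X * nc_gf \<noteq> 0"
proof -
  have "fps_nth nc_gf 0 = 1" "fps_nth (1 - X * nc_gf) 0 = 1" by simp_all
  then show "nc_gf \<noteq> 0" "1 - X * nc_gf \<noteq> 0" by (metis fps_zero_nth zero_neq_one)+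
qed

lemma phi_compose_nc: "phi oo (X * nc_gf) = X"
proof -
  let ?s = "X * nc_gf"
  have s0: "fps_nth ?s 0 = 0" by simp
  have "(phi * (1 - U * X)) oo ?s = (X * (1 - X)) oo ?s"
    by (simp add: phi_eq)
  then have "(phi oo ?s) * (1 - U * ?s) = ?s * (1 - ?s)"
    using s0 by (simp add: fps_compose_mult_distrib fps_compose_one_minus)
  then have "(phi oo ?s) * (nc_gf * (1 - ?s)) = X * (nc_gf * (1 - ?s))"
    by (simp add: nc_gf_eq' mult.assoc)
  then show ?thesis using nc_nz by simp
qed

text \<open>
  The sum over all ways to cut a circle of \<open>n\<close> points into arcs, with weight \<open>- y\<close> per arc. At
  least two arcs correspond to at least two cut points, and the single full arc is counted once and
  not \<open>n\<close> times.
\<close>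

definition empty_coeff :: "nat \<Rightarrow> real fps" where
  "empty_coeff n = (if n = 0 then 0 else (1 - fps_X) ^ n - 1 + (of_nat n - 1) * fps_X)"

definition empty_gf :: fps2 where "empty_gf = Abs_fps empty_coeff"

text \<open>The summands of \<open>empty_coeff\<close> have the series \<open>geo\<close>,
  \<open>1 / (1 - x)\<close> and \<open>x / (1 - x)^2\<close>. The left side multiplies by the
  common denominator.\<close>

lemma empty_gf_eq:
  "empty_gf * ((1 - X)\<^sup>2 * (1 - U * X)) = - (X * Y * (1 - 2 * X + U * X\<^sup>2))"
proof -
  define one where "one = (Abs_fps (\<lambda>_. 1) :: fps2)"
  define lin where "lin = (Abs_fps (\<lambda>n. of_nat n) :: fps2)"
  have one: "one * (1 - X) = 1"
  proof (rule fps_ext)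
    fix n
    have "one * (1 - X) = one - X * one" by (simp add: algebra_simps)
    then show "fps_nth (one * (1 - X)) n = fps_nth 1 n"
      by (cases n) (simp_all add: one_def)
  qed
  have lin: "lin * (1 - X) = X * one"
  proof (rule fps_ext)
    fix n
    have "lin * (1 - X) = lin - X * lin" by (simp add: algebra_simps)
    then show "fps_nth (lin * (1 - X)) n = fps_nth (X * one) n"
      by (cases n) (simp_all add: lin_def one_def)
  qed
  \<comment> \<open>The final \<open>Y\<close> corrects the coefficient at 0, where the other terms
    add up to \<open>- y\<close> but \<open>empty_coeff\<close> is 0.\<close>
  have G: "empty_gf = geo - one + Y * lin - Y * one + Y"
    by (rule fps_ext)
       (simp add: empty_gf_def empty_coeff_def geo_def one_def lin_def algebra_simps)
  have expand: "(g - i + y * l - y * i + y) * ((1 - x)\<^sup>2 * (1 - u * x)) =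
      (g * (1 - u * x)) * (1 - x)\<^sup>2 - (1 + y) * (i * (1 - x)) * (1 - x) * (1 - u * x)
      + y * (l * (1 - x)) * (1 - x) * (1 - u * x) + y * ((1 - x)\<^sup>2 * (1 - u * x))"
    for g i l x y u :: fps2
    by (simp add: power2_eq_square algebra_simps)
  have collect: "1 * (1 - x)\<^sup>2 - (1 + y) * 1 * (1 - x) * (1 - (1 - y) * x)
      + y * (x * i) * (1 - x) * (1 - (1 - y) * x) + y * ((1 - x)\<^sup>2 * (1 - (1 - y) * x)) =
      - (x * y * (1 - 2 * x + (1 - y) * x\<^sup>2))" if "i * (1 - x) = 1" for i x y :: fps2
  proof -
    have "y * (x * i) * (1 - x) * (1 - (1 - y) * x) = y * x * (1 - (1 - y) * x) * (i * (1 - x))"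
      by (simp only: ac_simps)
    then show ?thesis
      unfolding that by (simp add: power2_eq_square algebra_simps)
  qed
  show ?thesis
    unfolding G expand geo_eq one lin unfolding U_eq using collect[OF one] by simp
qed

lemma one_minus_X_nz: "1 - X \<noteq> 0" "1 - U * X \<noteq> 0"
proof -
  have "fps_nth (1 - X) 0 = 1" "fps_nth (1 - U * X) 0 = 1" by simp_all
  then show "1 - X \<noteq> 0" "1 - U * X \<noteq> 0" by (metis fps_zero_nth zero_neq_one)+
qed

text \<open>The polynomial \<open>1 - 2 x + (1 - y) x^2\<close> is a factor of the numerator of
  \<open>empty_gf\<close> and is also the numerator of the derivative of \<open>phi\<close>.
  Eliminating it expresses \<open>empty_gf\<close> by \<open>phi\<close> and its derivative, whose
  values at \<open>x D\<close> are under control.\<close>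

lemma empty_gf_phi: "empty_gf * phi * (1 - X) = - (X\<^sup>2 * Y * fps_deriv phi)"
proof -
  let ?c = "(1 - X) * (1 - U * X)\<^sup>2"
  have "fps_deriv (phi * (1 - U * X)) = fps_deriv (X * (1 - X))"
    by (simp only: phi_eq)
  then have "fps_deriv phi * (1 - U * X) - phi * U = 1 - 2 * X"
    by (simp add: algebra_simps)
  then have "(fps_deriv phi * (1 - U * X) - phi * U) * (1 - U * X) = (1 - 2 * X) * (1 - U * X)"
    by simp
  then have "fps_deriv phi * (1 - U * X)\<^sup>2 - phi * (1 - U * X) * U = (1 - 2 * X) * (1 - U * X)"
    by (simp add: power2_eq_square algebra_simps)
  then have "fps_deriv phi * (1 - U * X)\<^sup>2 = (1 - 2 * X) * (1 - U * X) + X * (1 - X) * U"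
    by (simp only: phi_eq) (simp add: algebra_simps)
  then have d: "fps_deriv phi * (1 - U * X)\<^sup>2 = 1 - 2 * X + U * X\<^sup>2"
    by (simp add: power2_eq_square algebra_simps)
  have "(empty_gf * phi * (1 - X)) * ?c =
      (phi * (1 - U * X)) * (empty_gf * ((1 - X)\<^sup>2 * (1 - U * X)))"
    by (simp add: power2_eq_square algebra_simps)
  also have "\<dots> = - (X\<^sup>2 * Y) * (1 - X) * (1 - 2 * X + U * X\<^sup>2)"
    unfolding phi_eq empty_gf_eq by (simp add: power2_eq_square algebra_simps)
  also have "\<dots> = - (X\<^sup>2 * Y * fps_deriv phi) * ?c"
    unfolding d[symmetric] by (simp add: algebra_simps)
  finally have "(empty_gf * phi * (1 - X)) * ?c = - (X\<^sup>2 * Y * fps_deriv phi) * ?c" .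
  moreover have "?c \<noteq> 0"
    using one_minus_X_nz by simp
  ultimately show ?thesis
    by (metis mult_right_cancel)
qed

lemma nc_deriv_phi: "(fps_deriv phi oo (X * nc_gf)) * fps_deriv (X * nc_gf) = 1"
proof -
  have "fps_deriv (phi oo (X * nc_gf)) = 1" by (simp only: phi_compose_nc fps_deriv_fps_X)
  then show ?thesis by (simp add: fps_compose_deriv)
qed

text \<open>Substituting \<open>s = x D\<close> in \<open>empty_gf_phi\<close> turns
  \<open>phi\<close> into \<open>x\<close>, and multiplying by the derivative of \<open>s\<close>
  cancels the derivative of \<open>phi\<close>. What remains is
  \<open>(1 - s) (1 - D) = - y s\<close>, a form of the functional equation.\<close>

lemma empty_gf_nc: "(empty_gf oo (X * nc_gf)) * fps_deriv (X * nc_gf) = nc_gf * (1 - nc_gf)"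
proof -
  let ?s = "X * nc_gf"
  let ?d = "fps_deriv ?s"
  have s0: "fps_nth ?s 0 = 0" by simp
  have "(empty_gf * phi * (1 - X)) oo ?s = (- (X\<^sup>2 * Y * fps_deriv phi)) oo ?s"
    by (simp only: empty_gf_phi)
  then have "(empty_gf oo ?s) * X * (1 - ?s) = - (?s\<^sup>2 * Y * (fps_deriv phi oo ?s))"
    using s0 by (simp add: fps_compose_mult_distrib fps_compose_one_minus fps_compose_uminus
        phi_compose_nc power2_eq_square)
  then have "(empty_gf oo ?s) * X * (1 - ?s) * ?d = - (?s\<^sup>2 * Y * ((fps_deriv phi oo ?s) * ?d))"
    by (simp only: mult.assoc mult_minus_left)
  then have "(empty_gf oo ?s) * X * (1 - ?s) * ?d = - (?s\<^sup>2 * Y)"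
    by (simp only: nc_deriv_phi mult_1_right)
  also have "\<dots> = X * (1 - ?s) * (nc_gf * (1 - nc_gf))"
  proof -
    have "(1 - ?s) * (1 - nc_gf) = 1 - ?s - nc_gf * (1 - ?s)" by (simp add: algebra_simps)
    also have "\<dots> = - (?s * Y)"
      unfolding nc_gf_eq' U_eq by (simp add: algebra_simps)
    finally have *: "(1 - ?s) * (1 - nc_gf) = - (?s * Y)" .
    have "X * (1 - ?s) * (nc_gf * (1 - nc_gf)) = ?s * ((1 - ?s) * (1 - nc_gf))"
      by (simp add: algebra_simps)
    then show ?thesis unfolding * by (simp add: power2_eq_square)
  qed
  finally have "X * (1 - ?s) * ((empty_gf oo ?s) * ?d) = X * (1 - ?s) * (nc_gf * (1 - nc_gf))"
    by (simp only: ac_simps)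
  then show ?thesis
    using nc_nz by simp
qed

text \<open>The last factor of the theorem is \<open>x\<close> times the logarithmic derivative of
  \<open>x D\<close>; this is the form in which the chain rule delivers it.\<close>

lemma nc_log_deriv: "nc_gf * (1 + X * (fps_deriv nc_gf / nc_gf)) = fps_deriv (X * nc_gf)"
proof -
  have "fps_deriv nc_gf / nc_gf * nc_gf = fps_deriv nc_gf"
    by (rule fps_divide_mult_cancel) (auto simp: fps_inverse_one)
  then show ?thesis
    by (simp add: algebra_simps)
qed

text \<open>At \<open>s = x D\<close> the hypothesis reads \<open>x T(s) = s phi'(s) Q\<close>, and
  \<open>phi'(s)\<close> is the reciprocal of the derivative of \<open>s\<close>. The hypothesis is
  multiplied out because \<open>phi\<close> has constant term 0 and is no unit.\<close>

lemma invert_substitution: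
  fixes Q T :: fps2
  assumes "phi * T = X * fps_deriv phi * (Q oo phi)"
  shows "Q = (T oo (X * nc_gf)) * (1 + X * (fps_deriv nc_gf / nc_gf))"
proof -
  let ?s = "X * nc_gf"
  let ?d = "fps_deriv ?s"
  have s0: "fps_nth ?s 0 = 0" by simp
  have "(Q oo phi) oo ?s = Q"
    using fps_compose_assoc[OF s0 phi_nth_0, of Q] by (simp add: phi_compose_nc)
  then have "X * (T oo ?s) = ?s * (fps_deriv phi oo ?s) * Q"
    using arg_cong[OF assms, of "\<lambda>f. f oo ?s"] s0
    by (simp add: fps_compose_mult_distrib phi_compose_nc)
  then have "X * (T oo ?s) * ?d = ?s * ((fps_deriv phi oo ?s) * ?d) * Q"
    by (simp only: ac_simps)
  then have "X * (T oo ?s) * ?d = ?s * Q"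
    by (simp only: nc_deriv_phi mult_1_right)
  then have "(X * nc_gf) * ((T oo ?s) * (1 + X * (fps_deriv nc_gf / nc_gf))) = (X * nc_gf) * Q"
    unfolding nc_log_deriv[symmetric] by (simp only: ac_simps)
  then show ?thesis using nc_nz by simp
qed

text \<open>The contribution of \<open>K = {}\<close> after the substitution. It accounts for the
  summand \<open>D\<close> when the class contains the empty permutation.\<close>

lemma empty_gf_invert:
  "(empty_gf oo (X * nc_gf)) * (1 + X * (fps_deriv nc_gf / nc_gf)) = 1 - nc_gf"
proof -
  have "nc_gf * ((empty_gf oo (X * nc_gf)) * (1 + X * (fps_deriv nc_gf / nc_gf))) =
      nc_gf * (1 - nc_gf)"
    using empty_gf_nc unfolding nc_log_deriv[symmetric] by (simp only: ac_simps)
  then show ?thesis using nc_nz by simp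
qed

text \<open>By \<open>nc_gf_sqrt\<close> the numerator is \<open>2 x (D - 1)\<close>. The division
  multiplies by the inverse of the unit factor 2 and then shifts by the subdegree 1 of the
  denominator.\<close>

lemma nc_gf_closed_form:
  "nc_gf = (1 - X - X * Y - fps_sqrt ((X + X * Y - 1)\<^sup>2 - 4 * X\<^sup>2 * Y)) / (2 * X) + 1"
proof -
  have sub: "subdegree (2 * X :: fps2) = 1"
    by (rule subdegreeI) (auto simp: fps_numeral_nth)
  have i2: "inverse (2::real fps) * 2 = 1"
    by (rule inverse_mult_eq_1) (simp add: fps_numeral_nth)
  have "inverse (2::fps2) * 2 = 1"
    using fps_left_inverse'[of "inverse (2::real fps)" "2::fps2" "inverse (2::real fps)"] i2
    by (simp add: fps_inverse_def fps_numeral_nth mult.commute)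
  moreover have "unit_factor (2 * X :: fps2) = 2"
    by (simp add: sub fps_eq_iff fps_numeral_nth)
  moreover have "2 * X * (nc_gf - 1) * inverse 2 = X * (nc_gf - 1) * (inverse 2 * 2)"
    by (simp only: ac_simps)
  ultimately have "(2 * X * (nc_gf - 1)) / (2 * X) = fps_shift 1 (X * (nc_gf - 1))"
    unfolding fps_divide_def by (simp only: sub mult_1_right)
  also have "\<dots> = nc_gf - 1"
    by (rule fps_ext) simp
  finally have "(2 * X * (nc_gf - 1)) / (2 * X) = nc_gf - 1" .
  then show ?thesis
    unfolding nc_gf_sqrt by simp
qed

subsection \<open>Cyclic successors\<close>

text \<open>Points outside \<open>A\<close> are allowed as arguments, which \<open>ahead\<close>
  exploits. In a singleton the only element is its own successor.\<close>

definition nxt :: "nat set \<Rightarrow> nat \<Rightarrow> nat" where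
  "nxt A a = (if \<exists>b\<in>A. a < b then Min {b \<in> A. a < b} else Min A)"

text \<open>The identity outside \<open>A\<close> makes this a permutation in the sense of
  \<open>permutes\<close>, so that it has an inverse.\<close>

definition rot :: "nat set \<Rightarrow> nat \<Rightarrow> nat" where
  "rot A a = (if a \<in> A then nxt A a else a)"

lemma nxt_greater:
  assumes "finite A" "\<exists>b\<in>A. a < b"
  shows "nxt A a \<in> A" "a < nxt A a" "\<And>b. b \<in> A \<Longrightarrow> a < b \<Longrightarrow> nxt A a \<le> b"
proof -
  have f: "finite {b \<in> A. a < b}" "{b \<in> A. a < b} \<noteq> {}"
    using assms by auto
  have n: "nxt A a = Min {b \<in> A. a < b}"
    using assms by (simp add: nxt_def)
  show "nxt A a \<in> A" "a < nxt A a"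
    using Min_in[OF f] n by auto
  show "nxt A a \<le> b" if "b \<in> A" "a < b" for b
    unfolding n using f that by (intro Min_le) auto
qed

lemma nxt_Min: "\<not> (\<exists>b\<in>A. a < b) \<Longrightarrow> nxt A a = Min A"
  unfolding nxt_def by argo

lemma nxt_in: "finite A \<Longrightarrow> A \<noteq> {} \<Longrightarrow> nxt A a \<in> A"
  by (cases "\<exists>b\<in>A. a < b") (auto simp: nxt_greater nxt_Min)

lemma nxt_eqI:
  assumes "finite A" "c \<in> A"
    and "\<And>b. b \<in> A \<Longrightarrow> a < b \<Longrightarrow> a < c \<and> c \<le> b"
    and "\<And>b. b \<in> A \<Longrightarrow> \<not> (\<exists>b\<in>A. a < b) \<Longrightarrow> c \<le> b"
  shows "nxt A a = c"
proof (cases "\<exists>b\<in>A. a < b")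
  case True
  then show ?thesis
    using nxt_greater[OF assms(1) True] assms(2,3) by (metis antisym)
next
  case False
  then show ?thesis
    using assms by (auto simp: nxt_Min intro!: Min_eqI)
qed

lemma nxt_Icc: "a \<in> {1..n} \<Longrightarrow> nxt {1..n} a = (if a < n then Suc a else 1)"
  by (rule nxt_eqI) (auto split: if_splits)

lemma inj_on_nxt:
  assumes "finite A"
  shows "inj_on (nxt A) A"
proof -
  have "nxt A a \<noteq> nxt A c" if "a \<in> A" "c \<in> A" "a < c" for a c
  proof (cases "\<exists>b\<in>A. c < b")
    case True
    have ex: "\<exists>b\<in>A. a < b" using that by auto
    show ?thesis
      using nxt_greater(2)[OF assms True] nxt_greater(3)[OF assms ex that(2,3)] by simp
  next
    case False
    then have "nxt A c \<le> a" using assms that by (simp add: nxt_Min)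
    then show ?thesis using nxt_greater(2)[OF assms, of a] that by force
  qed
  then show ?thesis by (metis inj_onI linorder_neqE_nat)
qed

lemma rot_permutes:
  assumes "finite A"
  shows "rot A permutes A"
proof (cases "A = {}")
  case False
  have "inj_on (rot A) A"
    using inj_on_nxt[OF assms] by (simp add: rot_def inj_on_def)
  moreover have "rot A ` A \<subseteq> A"
    using nxt_in[OF assms False] by (auto simp: rot_def)
  ultimately have "bij_betw (rot A) A A"
    using assms by (simp add: bij_betw_def endo_inj_surj)
  then show ?thesis
    by (rule bij_imp_permutes) (simp add: rot_def)
qed (auto simp: rot_def permutes_def)

text \<open>This is what keeps a trivial cycle trivial when other points are deleted: its successor
  steps end inside the cycle itself.\<close>

lemma nxt_subset:
  assumes "finite A" "B \<subseteq> A" "a \<in> A" "nxt A a \<in> B"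
  shows "nxt B a = nxt A a"
proof (rule nxt_eqI)
  show "finite B" using assms finite_subset by blast
  show "a < nxt A a \<and> nxt A a \<le> b" if "b \<in> B" "a < b" for b
    using nxt_greater[OF assms(1), of a] that assms by blast
  show "nxt A a \<le> b" if "b \<in> B" "\<not> (\<exists>b\<in>B. a < b)" for b
  proof (cases "\<exists>b\<in>A. a < b")
    case True
    then show ?thesis using nxt_greater(2)[OF assms(1) True] assms that by blast
  next
    case False
    then show ?thesis using assms that by (auto simp: nxt_Min)
  qed
qed (use assms in auto)

lemma nxt_self:
  assumes "finite A" "a \<in> A" "nxt A a = a"
  shows "A = {a}"
proof -
  have ne: "\<not> (\<exists>b\<in>A. a < b)"
    using nxt_greater(2)[OF assms(1)] assms(3) by force
  then have "a = Min A" using nxt_Min assms(3) by metis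
  then have "b = a" if "b \<in> A" for b
    using Min_le[OF assms(1) that] ne that by (metis le_neq_implies_less)
  then show ?thesis using assms(2) by blast
qed

text \<open>From \<open>a\<close> the set reaches \<open>n\<close>, wraps around to 1 and climbs
  again. It applies to an orbit on which the permutation takes only successor steps.\<close>

lemma nxt_closed_Icc:
  assumes "a \<in> B" "B \<subseteq> {1..n}" "\<And>b. b \<in> B \<Longrightarrow> nxt {1..n} b \<in> B"
  shows "B = {1..n}"
proof -
  have up: "c + d \<in> B" if "c \<in> B" "c + d \<le> n" for c d
    using that(2)
  proof (induction d)
    case (Suc d)
    then have "c + d \<in> B" by simp
    then show ?case
      using assms(3)[of "c + d"] assms(2) Suc.prems nxt_Icc[of "c + d" n] by auto
  qed (simp add: that(1))
  have n: "1 \<le> a" "a \<le> n" using assms by auto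
  then have "n \<in> B" using up[OF assms(1), of "n - a"] by simp
  then have one: "1 \<in> B" using assms(3)[of n] nxt_Icc[of n n] n by auto
  have "b \<in> B" if "b \<in> {1..n}" for b
    using up[OF one, of "b - 1"] that by simp
  then show ?thesis using assms(2) by blast
qed

text \<open>
  The first element of \<open>Z\<close> met when walking cyclically upwards from \<open>a\<close>, with \<open>a\<close> included. It is
  constant on every interval that ends at an element of \<open>Z\<close>, which separates these intervals.
\<close>

definition ahead :: "nat set \<Rightarrow> nat \<Rightarrow> nat" where
  "ahead Z a = (if a \<in> Z then a else nxt Z a)"

text \<open>Walking from the next point with that point included meets the same first element of
  \<open>Z\<close> as walking from \<open>a\<close> with \<open>a\<close> excluded.\<close>

lemma ahead_nxt_Icc:
  assumes "Z \<subseteq> {1..n}" "Z \<noteq> {}" "a \<in> {1..n}"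
  shows "ahead Z (nxt {1..n} a) = nxt Z a"
proof -
  have fin: "finite Z" using assms finite_subset by blast
  note a = nxt_Icc[OF assms(3)]
  show ?thesis
  proof (cases "nxt {1..n} a \<in> Z")
    case True
    then show ?thesis
      using nxt_subset[of "{1..n}" Z a] assms by (simp add: ahead_def)
  next
    case F: False
    have "nxt Z (nxt {1..n} a) = nxt Z a"
    proof (cases "\<exists>b\<in>Z. a < b")
      case True
      then have an: "a < n" using assms by fastforce
      note g = nxt_greater[OF fin True]
      have "nxt Z a \<noteq> Suc a" using g F a an by auto
      with g show ?thesis
        using a an by (intro nxt_eqI[OF fin]) (auto simp: Suc_le_eq order.strict_iff_order)
    next
      case False
      show ?thesis
      proof (cases "a < n")
        case True
        then have "\<not> (\<exists>b\<in>Z. nxt {1..n} a < b)" using a False by force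
        then show ?thesis using False by (simp add: nxt_Min)
      next
        case an: False
        have "1 < b" if "b \<in> Z" for b
          using that F a an assms(1) by (metis atLeastAtMost_iff nat_less_le subsetD)
        moreover have "nxt Z 1 = Min Z"
          using fin assms(2) calculation by (intro nxt_eqI) auto
        ultimately show ?thesis using a an False by (simp add: nxt_Min)
      qed
    qed
    then show ?thesis using F by (simp add: ahead_def)
  qed
qed

subsection \<open>Weights of sets of kept points\<close>

text \<open>For nonempty \<open>K\<close>, the sum of \<open>(- y)^|E|\<close> over the possible
  sets \<open>E\<close> of arc ends: a removed point in front of a kept one must be an end, every
  other removed point is free.\<close>

definition wt :: "nat \<Rightarrow> nat set \<Rightarrow> real fps" where
  "wt n K = (\<Prod>a\<in>{1..n} - K. if nxt {1..n} a \<in> K then - fps_X else 1 - fps_X)"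

definition wt_sum :: "nat \<Rightarrow> nat \<Rightarrow> real fps" where
  "wt_sum n m = (\<Sum>K | K \<subseteq> {1..n} \<and> card K = m. wt n K)"

text \<open>A removed point \<open>n\<close> has no factor yet, since its factor depends on whether
  \<open>n + 1\<close> is kept. It is supplied when the line is extended by one point.\<close>

definition lin_wt :: "nat \<Rightarrow> nat set \<Rightarrow> real fps" where
  "lin_wt n K = (\<Prod>a\<in>{1..<n} - K. if Suc a \<in> K then - fps_X else 1 - fps_X)"

text \<open>In the linear sums, position \<open>0\<close> counts as kept: it stands for position \<open>n\<close>.\<close>

definition kept_sum :: "nat \<Rightarrow> nat \<Rightarrow> real fps" where
  "kept_sum n m = (\<Sum>K | K \<subseteq> {1..n} \<and> card K = m \<and> (n = 0 \<or> n \<in> K). lin_wt n K)"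

definition removed_sum :: "nat \<Rightarrow> nat \<Rightarrow> real fps" where
  "removed_sum n m = (\<Sum>K | K \<subseteq> {1..n} \<and> card K = m \<and> \<not> (n = 0 \<or> n \<in> K). lin_wt n K)"

lemma finite_subsets_Icc [simp]: "finite {K. K \<subseteq> {1..n::nat} \<and> P K}"
  by (rule finite_subset[of _ "Pow {1..n}"]) auto

lemma wt_rot: 
  assumes "K \<subseteq> {1..n}"
  shows "wt n (rot {1..n} ` K) = wt n K"
proof -
  let ?r = "rot {1..n}"
  have p: "?r permutes {1..n}" by (rule rot_permutes) simp
  have im: "?r ` ({1..n} - K) = {1..n} - ?r ` K"
    by (metis image_set_diff permutes_image permutes_inj p)
  have "wt n (?r ` K) = (\<Prod>a\<in>?r ` ({1..n} - K). if nxt {1..n} a \<in> ?r ` K then - fps_X else 1 - fps_X)"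
    unfolding wt_def im ..
  also have "\<dots> = (\<Prod>a\<in>{1..n} - K. if nxt {1..n} (?r a) \<in> ?r ` K then - fps_X else 1 - fps_X)"
    by (subst prod.reindex) (use inj_on_subset[OF permutes_inj[OF p]] in auto)
  also have "\<dots> = wt n K"
    unfolding wt_def
  proof (rule prod.cong)
    fix a assume a: "a \<in> {1..n} - K"
    then have "nxt {1..n} a \<in> {1..n}" by (intro nxt_in) auto
    then have "nxt {1..n} (?r a) = ?r (nxt {1..n} a)" using a by (simp add: rot_def)
    then show "(if nxt {1..n} (?r a) \<in> ?r ` K then - fps_X else 1 - fps_X) =
        (if nxt {1..n} a \<in> K then - fps_X else 1 - fps_X :: real fps)"
      using inj_image_mem_iff[OF permutes_inj[OF p]] by simp
  qed simp
  finally show ?thesis .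
qed

section \<open>Rotating the circle and cutting it open at a kept point\<close>

definition pointed_sum :: "nat \<Rightarrow> nat \<Rightarrow> nat \<Rightarrow> real fps" where
  "pointed_sum n m k = (\<Sum>K | K \<subseteq> {1..n} \<and> card K = m \<and> k \<in> K. wt n K)"

lemma pointed_sum_rot: "pointed_sum n m (rot {1..n} k) = pointed_sum n m k"
proof -
  let ?r = "rot {1..n}"
  have p: "?r permutes {1..n}" by (rule rot_permutes) simp
  note i = permutes_inj[OF p]
  show ?thesis
    unfolding pointed_sum_def
  proof (rule sum.reindex_bij_witness[of _ "\<lambda>K. ?r ` K" "\<lambda>K. inv ?r ` K"])
    fix K assume K: "K \<in> {K. K \<subseteq> {1..n} \<and> card K = m \<and> ?r k \<in> K}"
    show "?r ` (inv ?r ` K) = K"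
      by (simp only: image_comp permutes_inv_o[OF p] image_id id_apply)
    have "inv ?r ` K \<subseteq> {1..n}" using K permutes_image[OF permutes_inv[OF p]] by blast
    moreover have "card (inv ?r ` K) = m"
      using K card_image[OF inj_on_subset[OF permutes_inj[OF permutes_inv[OF p]] subset_UNIV], of K]
      by simp
    moreover have "k \<in> inv ?r ` K"
      using K permutes_inverses(2)[OF p, of k] by (metis (mono_tags, lifting) image_eqI mem_Collect_eq)
    ultimately show "inv ?r ` K \<in> {K. K \<subseteq> {1..n} \<and> card K = m \<and> k \<in> K}" by blast
    then show "wt n (inv ?r ` K) = wt n K"
      using wt_rot[of "inv ?r ` K" n] \<open>?r ` (inv ?r ` K) = K\<close> by simp
  next
    fix K assume K: "K \<in> {K. K \<subseteq> {1..n} \<and> card K = m \<and> k \<in> K}"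
    show "inv ?r ` (?r ` K) = K"
      by (simp only: image_comp permutes_inv_o[OF p] image_id id_apply)
    show "?r ` K \<in> {K. K \<subseteq> {1..n} \<and> card K = m \<and> ?r k \<in> K}"
      using K permutes_image[OF p] card_image[OF inj_on_subset[OF i subset_UNIV], of K] by blast
  qed
qed

lemma pointed_sum_eq:
  assumes "k \<in> {1..n}"
  shows "pointed_sum n m k = pointed_sum n m n"
proof -
  have "pointed_sum n m (n - j) = pointed_sum n m n" if "j < n" for j
    using that
  proof (induction j)
    case (Suc j)
    then have "rot {1..n} (n - Suc j) = n - j" by (auto simp: rot_def nxt_Icc)
    then show ?case using pointed_sum_rot[of n m "n - Suc j"] Suc by simp
  qed simp
  from this[of "n - k"] assms show ?thesis by simp
qed

lemma pointed_sum_kept: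
  assumes "n \<ge> 1"
  shows "pointed_sum n m n = kept_sum n m"
  unfolding pointed_sum_def kept_sum_def
proof (rule sum.cong)
  fix K assume K: "K \<in> {K. K \<subseteq> {1..n} \<and> card K = m \<and> (n = 0 \<or> n \<in> K)}"
  then have "{1..n} - K = {1..<n} - K" using assms by (auto simp: nat_less_le)
  then show "wt n K = lin_wt n K"
    unfolding wt_def lin_wt_def by (intro prod.cong) (auto simp: nxt_Icc)
qed (use assms in auto)

text \<open>Double counting of the pairs of a set \<open>K\<close> and a point in it. By rotation
  each of the \<open>n\<close> points contributes the same, and pointing at \<open>n\<close> cuts
  the circle into a line.\<close>

lemma wt_sum_kept:
  assumes "n \<ge> 1"
  shows "of_nat m * wt_sum n m = of_nat n * kept_sum n m"
proof -
  have "of_nat m * wt_sum n m =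
      (\<Sum>K | K \<subseteq> {1..n} \<and> card K = m. \<Sum>k\<in>{1..n}. if k \<in> K then wt n K else 0)"
    unfolding wt_sum_def sum_distrib_left
  proof (rule sum.cong)
    fix K assume K: "K \<in> {K. K \<subseteq> {1..n} \<and> card K = m}"
    then have "{k \<in> {1..n}. k \<in> K} = K" by auto
    then show "of_nat m * wt n K = (\<Sum>k\<in>{1..n}. if k \<in> K then wt n K else 0)"
      using K by (simp add: sum.inter_filter[symmetric])
  qed simp
  also have "\<dots> = (\<Sum>k\<in>{1..n}. pointed_sum n m k)"
  proof (subst sum.swap, rule sum.cong)
    fix k
    show "(\<Sum>K | K \<subseteq> {1..n} \<and> card K = m. if k \<in> K then wt n K else 0) = pointed_sum n m k"
      using sum.inter_filter[of "{K. K \<subseteq> {1..n} \<and> card K = m}" "wt n" "\<lambda>K. k \<in> K"]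
      by (simp add: pointed_sum_def conj_assoc)
  qed simp
  also have "\<dots> = (\<Sum>k\<in>{1..n}. kept_sum n m)"
    by (intro sum.cong refl) (metis pointed_sum_eq pointed_sum_kept[OF assms])
  finally show ?thesis by simp
qed

section \<open>Transfer recurrences along the line\<close>

lemma lin_wt_insert:
  assumes "K \<subseteq> {1..n}"
  shows "lin_wt (Suc n) (insert (Suc n) K) = lin_wt n K * (if n = 0 \<or> n \<in> K then 1 else - fps_X)"
proof -
  have *: "(\<Prod>a\<in>{1..<n} - K. if Suc a \<in> insert (Suc n) K then - fps_X else 1 - fps_X) = lin_wt n K"
    unfolding lin_wt_def by (intro prod.cong) auto
  show ?thesis
  proof (cases "n = 0 \<or> n \<in> K")
    case True
    then have "{1..<Suc n} - insert (Suc n) K = {1..<n} - K" by (auto simp: less_Suc_eq)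
    then show ?thesis
      using True * unfolding lin_wt_def[of "Suc n"] by simp
  next
    case False
    then have "{1..<Suc n} - insert (Suc n) K = insert n ({1..<n} - K)" by (auto simp: less_Suc_eq)
    then show ?thesis
      using False * unfolding lin_wt_def[of "Suc n"] by simp
  qed
qed

lemma lin_wt_Suc:
  assumes "K \<subseteq> {1..n}"
  shows "lin_wt (Suc n) K = lin_wt n K * (if n = 0 \<or> n \<in> K then 1 else 1 - fps_X)"
proof (cases "n = 0 \<or> n \<in> K")
  case True
  then have "{1..<Suc n} - K = {1..<n} - K" by (auto simp: less_Suc_eq)
  then show ?thesis using True by (simp add: lin_wt_def)
next
  case False
  then have "{1..<Suc n} - K = insert n ({1..<n} - K)" by (auto simp: less_Suc_eq)
  moreover have "Suc n \<notin> K" using assms by auto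
  ultimately show ?thesis using False by (simp add: lin_wt_def)
qed

lemma split_last:
  "(\<Sum>K | K \<subseteq> {1..n} \<and> card K = m. lin_wt n K * (if n = 0 \<or> n \<in> K then c else d)) =
   kept_sum n m * c + removed_sum n m * d"
proof -
  have "(\<Sum>K | K \<subseteq> {1..n} \<and> card K = m. lin_wt n K * (if n = 0 \<or> n \<in> K then c else d)) =
    (\<Sum>K | K \<subseteq> {1..n} \<and> card K = m. if n = 0 \<or> n \<in> K then lin_wt n K * c else lin_wt n K * d)"
    by (intro sum.cong) auto
  also have "\<dots> = (\<Sum>K\<in>{K. K \<subseteq> {1..n} \<and> card K = m} \<inter> {K. n = 0 \<or> n \<in> K}. lin_wt n K * c) +
      (\<Sum>K\<in>{K. K \<subseteq> {1..n} \<and> card K = m} \<inter> - {K. n = 0 \<or> n \<in> K}. lin_wt n K * d)"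
    by (rule sum.If_cases) simp
  also have "{K. K \<subseteq> {1..n} \<and> card K = m} \<inter> {K. n = 0 \<or> n \<in> K} =
      {K. K \<subseteq> {1..n} \<and> card K = m \<and> (n = 0 \<or> n \<in> K)}" by auto
  also have "{K. K \<subseteq> {1..n} \<and> card K = m} \<inter> - {K. n = 0 \<or> n \<in> K} =
      {K. K \<subseteq> {1..n} \<and> card K = m \<and> \<not> (n = 0 \<or> n \<in> K)}" by auto
  finally show ?thesis
    by (simp add: kept_sum_def removed_sum_def sum_distrib_right)
qed

lemma kept_sum_Suc_Suc: "kept_sum (Suc n) (Suc m) = kept_sum n m - fps_X * removed_sum n m"
proof -
  have "kept_sum (Suc n) (Suc m) =
      (\<Sum>K | K \<subseteq> {1..n} \<and> card K = m. lin_wt (Suc n) (insert (Suc n) K))"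
    unfolding kept_sum_def
  proof (rule sum.reindex_bij_witness[of _ "insert (Suc n)" "\<lambda>K. K - {Suc n}"])
    fix K assume K: "K \<in> {K. K \<subseteq> {1..Suc n} \<and> card K = Suc m \<and> (Suc n = 0 \<or> Suc n \<in> K)}"
    then have "finite K" by (auto intro: finite_subset)
    with K show "K - {Suc n} \<in> {K. K \<subseteq> {1..n} \<and> card K = m}"
      by (auto simp: atLeastAtMostSuc_conv)
    show "insert (Suc n) (K - {Suc n}) = K" using K by auto
    then show "lin_wt (Suc n) (insert (Suc n) (K - {Suc n})) = lin_wt (Suc n) K" by simp
  next
    fix K assume K: "K \<in> {K. K \<subseteq> {1..n} \<and> card K = m}"
    then have "finite K" "Suc n \<notin> K" by (auto intro: finite_subset)
    with K show "insert (Suc n) K - {Suc n} = K"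
      "insert (Suc n) K \<in> {K. K \<subseteq> {1..Suc n} \<and> card K = Suc m \<and> (Suc n = 0 \<or> Suc n \<in> K)}"
      by auto
  qed
  also have "\<dots> = (\<Sum>K | K \<subseteq> {1..n} \<and> card K = m. lin_wt n K * (if n = 0 \<or> n \<in> K then 1 else - fps_X))"
    by (intro sum.cong) (auto simp: lin_wt_insert)
  finally show ?thesis unfolding split_last by (simp add: mult.commute)
qed

lemma removed_sum_Suc: "removed_sum (Suc n) m = kept_sum n m + (1 - fps_X) * removed_sum n m"
proof -
  have "{K. K \<subseteq> {1..Suc n} \<and> card K = m \<and> \<not> (Suc n = 0 \<or> Suc n \<in> K)} =
      {K. K \<subseteq> {1..n} \<and> card K = m}"
    by (auto simp: atLeastAtMostSuc_conv)
  then have "removed_sum (Suc n) m =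
      (\<Sum>K | K \<subseteq> {1..n} \<and> card K = m. lin_wt n K * (if n = 0 \<or> n \<in> K then 1 else 1 - fps_X))"
    unfolding removed_sum_def by (intro sum.cong) (auto simp: lin_wt_Suc)
  then show ?thesis unfolding split_last by (simp add: mult.commute)
qed

lemma kept_sum_0: "kept_sum 0 m = (if m = 0 then 1 else 0)"
proof -
  have "{K. K \<subseteq> {1..0::nat} \<and> card K = m \<and> (0 = (0::nat) \<or> 0 \<in> K)} = (if m = 0 then {{}} else {})"
    by auto
  then show ?thesis by (simp add: kept_sum_def lin_wt_def)
qed

lemma kept_sum_Suc_0: "kept_sum (Suc n) 0 = 0"
proof -
  have "card K \<noteq> 0" if "K \<subseteq> {1..Suc n}" "Suc n \<in> K" for K
    using that finite_subset[of K "{1..Suc n}"] by auto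
  then have "{K. K \<subseteq> {1..Suc n} \<and> card K = 0 \<and> (Suc n = 0 \<or> Suc n \<in> K)} = {}"
    by blast
  then show ?thesis unfolding kept_sum_def by (simp only: sum.empty)
qed

text \<open>The recurrences in the state of the last point give a linear system for the series
  \<open>a\<close> and \<open>b\<close> of kept and removed last points. Eliminating
  \<open>b\<close> leaves the factor \<open>phi\<close> for each kept point together with the gap
  before it.\<close>

lemma kept_sum_eq_power: "kept_sum n m = fps_nth (phi ^ m) n"
proof -
  define a where "a m = Abs_fps (\<lambda>n. kept_sum n m)" for m
  define b where "b m = Abs_fps (\<lambda>n. removed_sum n m)" for m
  have a0: "a 0 = 1"
  proof (rule fps_ext)
    show "fps_nth (a 0) n = fps_nth 1 n" for n
      by (cases n) (simp_all add: a_def kept_sum_0 kept_sum_Suc_0)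
  qed
  have a: "a (Suc m) = X * (a m - Y * b m)" for m
  proof (rule fps_ext)
    show "fps_nth (a (Suc m)) n = fps_nth (X * (a m - Y * b m)) n" for n
      by (cases n) (simp_all add: a_def b_def kept_sum_0 kept_sum_Suc_Suc)
  qed
  have b: "b m = X * (a m + U * b m)" for m
  proof (rule fps_ext)
    show "fps_nth (b m) n = fps_nth (X * (a m + U * b m)) n" for n
      by (cases n) (simp_all add: a_def b_def removed_sum_Suc, simp add: removed_sum_def)
  qed
  have step: "a (Suc m) = phi * a m" for m
  proof -
    have b': "b m * (1 - U * X) = X * a m"
      using b[of m] by (simp add: algebra_simps)
    have "a (Suc m) * (1 - U * X) = X * (a m * (1 - U * X) - Y * (b m * (1 - U * X)))"
      unfolding a by (simp only: algebra_simps)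
    also have "\<dots> = X * (1 - X) * a m"
      unfolding b' unfolding U_eq by (simp add: algebra_simps)
    also have "\<dots> = phi * a m * (1 - U * X)"
      unfolding phi_eq[symmetric] by (simp only: ac_simps)
    finally show ?thesis using one_minus_X_nz by simp
  qed
  have "a m = phi ^ m"
    by (induction m) (simp_all add: a0 step)
  then show ?thesis
    unfolding a_def by (metis fps_nth_Abs_fps)
qed

subsection \<open>Orbits that are arcs\<close>

text \<open>
  A cycle is trivial if and only if all of its points but one are mapped to their cyclic successor.
  Stating this relative to an arbitrary set avoids relabeling when several cycles are removed.
\<close>

definition arcs :: "nat set \<Rightarrow> (nat \<Rightarrow> nat) \<Rightarrow> nat set set" where
  "arcs A \<sigma> = {B \<in> orbit \<sigma> ` A. \<exists>e\<in>B. \<forall>a\<in>B - {e}. \<sigma> a = nxt A a}"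

lemma permutes_self_in_orbit: "\<sigma> permutes A \<Longrightarrow> finite A \<Longrightarrow> x \<in> orbit \<sigma> x"
  by (meson permutation_permutes permutation_self_in_orbit)

lemma permutes_orbit_eq:
  "\<sigma> permutes A \<Longrightarrow> finite A \<Longrightarrow> y \<in> orbit \<sigma> x \<Longrightarrow> orbit \<sigma> y = orbit \<sigma> x"
  by (rule orbit_cyclic_eq3[OF cyclic_on_orbit])

lemma cycle_of_list_nth:
  assumes "distinct cs" "j < length cs"
  shows "cycle_of_list cs (cs ! j) = cs ! (Suc j mod length cs)"
proof -
  have "map (cycle_of_list cs) cs = rotate1 cs"
    using cyclic_rotation[OF assms(1), of 1] by (simp add: One_nat_def)
  then have "map (cycle_of_list cs) cs ! j = rotate1 cs ! j" by simp
  then show ?thesis using assms by (simp add: nth_rotate1)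
qed

lemma nxt_mod:
  assumes "n > 0"
  shows "nxt {1..n} (x mod n + 1) = Suc x mod n + 1"
proof -
  define r where "r = x mod n"
  have "r < n" using assms by (simp add: r_def)
  then show ?thesis
    using nxt_Icc[of "r + 1" n] unfolding mod_Suc r_def[symmetric] by auto
qed

text \<open>The excepted point is the last entry \<open>f p\<close>, which is sent back to
  \<open>f 0\<close>. The bound \<open>p < n\<close> makes the entries distinct, and closure under
  \<pi> identifies them with the orbit of \<open>f 0\<close>.\<close>

lemma trivial_cycle_imp_arc:
  assumes "\<pi> permutes {1..n}" "trivial_cycle n \<pi> cs"
  shows "set cs \<in> arcs {1..n} \<pi>"
proof -
  from assms(2) obtain i p where i: "i \<in> {1..n}" and p: "p < n"
    and cs: "cs = map (\<lambda>j. (i - 1 + j) mod n + 1) [0..<Suc p]"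
    and \<pi>: "\<forall>a\<in>set cs. \<pi> a = cycle_of_list cs a"
    unfolding trivial_cycle_def by blast
  define f where "f j = (i - 1 + j) mod n + 1" for j
  have cs: "cs = map f [0..<Suc p]" unfolding cs f_def ..
  have n: "n > 0" using p by simp
  have len: "length cs = Suc p" by (simp add: cs)
  have nth: "cs ! j = f j" if "j \<le> p" for j
    unfolding cs using that by (subst nth_map) (simp_all del: upt_Suc)
  have "f j \<noteq> f k" if "j < k" "k \<le> p" for j k
  proof
    assume "f j = f k"
    then have "n dvd k - j"
      using that mod_eq_dvd_iff_nat[of "i - 1 + j" "i - 1 + k" n] by (simp add: f_def)
    then show False using that p nat_dvd_not_less[of "k - j" n] by simp
  qed
  then have "inj_on f {0..<Suc p}"
    by (metis atLeastLessThan_iff inj_onI less_Suc_eq_le linorder_neqE_nat)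
  then have dist: "distinct cs" unfolding cs distinct_map by (simp del: upt_Suc)
  have step: "\<pi> (f j) = f (Suc j mod Suc p)" if "j \<le> p" for j
  proof -
    have "f j \<in> set cs" using that nth[OF that] len by (metis le_imp_less_Suc nth_mem)
    moreover have "Suc j mod Suc p \<le> p" using less_Suc_eq_le by auto
    ultimately show ?thesis
      using \<pi> cycle_of_list_nth[OF dist, of j] that by (simp add: nth len)
  qed
  have set: "set cs = f ` {..p}" by (auto simp: cs simp del: upt_Suc)
  have "f j \<in> {1..n}" for j
    using mod_less_divisor[OF n, of "i - 1 + j"] unfolding f_def atLeastAtMost_iff by linarith
  then have sub: "f ` {..p} \<subseteq> {1..n}" by blast
  have self: "f 0 \<in> orbit \<pi> (f 0)" using permutes_self_in_orbit[OF assms(1)] by simp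
  have "f j \<in> orbit \<pi> (f 0)" if "j \<le> p" for j
    using that
  proof (induction j)
    case (Suc j)
    then have "\<pi> (f j) = f (Suc j)" using step[of j] by simp
    then show ?case using Suc by (metis Suc_leD orbit.step)
  qed (rule self)
  moreover have "x \<in> f ` {..p}" if "x \<in> orbit \<pi> (f 0)" for x
    using that
  proof induction
    case base
    then show ?case using step[of 0] by (simp add: less_Suc_eq_le[symmetric])
  next
    case (step y)
    then obtain j where "j \<le> p" "y = f j" by auto
    then show ?case using \<open>\<And>j. j \<le> p \<Longrightarrow> \<pi> (f j) = f (Suc j mod Suc p)\<close>[of j]
      by (simp add: less_Suc_eq_le[symmetric])
  qed
  ultimately have orb: "set cs = orbit \<pi> (f 0)" unfolding set by blast
  have "\<pi> a = nxt {1..n} a" if a: "a \<in> set cs - {f p}" for a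
  proof -
    from a obtain j where j: "j \<le> p" "a = f j" "j \<noteq> p" by (auto simp: set)
    then show ?thesis using step[of j] nxt_mod[OF n, of "i - 1 + j"] by (simp add: f_def)
  qed
  moreover have "f p \<in> set cs" by (simp add: set)
  ultimately have "\<exists>e\<in>set cs. \<forall>a\<in>set cs - {e}. \<pi> a = nxt {1..n} a" by blast
  moreover have "set cs \<in> orbit \<pi> ` {1..n}" using orb sub by blast
  ultimately show ?thesis unfolding arcs_def by blast
qed

lemma arc_imp_trivial_cycle:
  assumes "\<pi> permutes {1..n}" "B \<in> arcs {1..n} \<pi>"
  shows "\<exists>cs. trivial_cycle n \<pi> cs \<and> set cs = B"
proof -
  from assms(2) obtain x e where x: "x \<in> {1..n}" "B = orbit \<pi> x" and e: "e \<in> B"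
    and nx: "\<And>a. a \<in> B \<Longrightarrow> a \<noteq> e \<Longrightarrow> \<pi> a = nxt {1..n} a"
    unfolding arcs_def by blast
  \<comment> \<open>The list starts at the image of the excepted point, so that this point comes
    last and all earlier steps are successor steps.\<close>
  define i where "i = \<pi> e"
  have sub: "B \<subseteq> {1..n}" using permutes_orbit_subset[OF assms(1) x(1)] x(2) by simp
  have iB: "i \<in> B" using e x(2) by (auto simp: i_def intro: orbit.step)
  have B: "B = orbit \<pi> i" using permutes_orbit_eq[OF assms(1) _ iB[unfolded x(2)]] x(2) by simp
  have self: "i \<in> orbit \<pi> i" using iB B by simp
  define d where "d = funpow_dist1 \<pi> i i"
  define g where "g j = (\<pi> ^^ j) i" for j
  have Bg: "B = g ` {0..<d}"
    using orbit_conv_funpow_dist1[OF self] by (simp add: B g_def d_def)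
  have inj: "inj_on g {0..<d}"
    using inj_on_funpow_dist1[OF self] unfolding g_def d_def .
  have gd: "g d = i" using funpow_dist1_prop[OF self] by (simp add: g_def d_def)
  have d0: "d > 0" by (simp add: d_def)
  have gS: "g (Suc j) = \<pi> (g j)" for j by (simp add: g_def)
  have last: "g (d - 1) = e"
    using gd gS[of "d - 1"] d0 permutes_inj[OF assms(1)] by (simp add: i_def inj_def)
  have "card B = d" using Bg inj by (simp add: card_image)
  then have dn: "d \<le> n" using card_mono[OF _ sub] by simp
  have n: "n > 0" using x(1) by auto
  have i: "i \<in> {1..n}" using iB sub by blast
  define f where "f j = (i - 1 + j) mod n + 1" for j
  have fg: "g j = f j" if "j < d" for j
    using that
  proof (induction j)
    case 0
    then show ?case using i by (auto simp: g_def f_def)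
  next
    case (Suc j)
    have "g j \<in> B" unfolding Bg using Suc.prems by (intro imageI) simp
    moreover have "g j \<noteq> e"
      using inj_onD[OF inj, of j "d - 1"] Suc.prems last by auto
    ultimately have "g (Suc j) = nxt {1..n} (g j)" using nx gS by simp
    then show ?case using Suc nxt_mod[OF n, of "i - 1 + j"] by (simp add: f_def)
  qed
  define cs where "cs = map f [0..<d]"
  have cs: "cs = map g [0..<d]" unfolding cs_def using fg by simp
  have dist: "distinct cs" unfolding cs distinct_map using inj by simp
  have "\<pi> a = cycle_of_list cs a" if "a \<in> set cs" for a
  proof -
    from that obtain j where j: "j < d" "a = g j" by (auto simp: cs)
    have "cycle_of_list cs a = cs ! (Suc j mod d)"
      using cycle_of_list_nth[OF dist, of j] j by (simp add: cs)
    also have "\<dots> = g (Suc j)"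
      using j gd d0 by (cases "Suc j = d") (auto simp: cs g_def)
    finally show ?thesis using gS j by simp
  qed
  moreover have "\<exists>p<n. cs = map f [0..<Suc p]"
    using dn d0 by (intro exI[of _ "d - 1"]) (auto simp: cs_def)
  ultimately have "trivial_cycle n \<pi> cs"
    unfolding trivial_cycle_def using i by (auto simp: f_def[abs_def])
  moreover have "set cs = B" by (simp add: cs Bg)
  ultimately show ?thesis by blast
qed

lemma reduced_perm_iff:
  "\<pi> permutes {1..n} \<Longrightarrow> reduced_perm n \<pi> \<longleftrightarrow> arcs {1..n} \<pi> = {}"
  unfolding reduced_perm_def using trivial_cycle_imp_arc arc_imp_trivial_cycle by blast

subsection \<open>Relabeling\<close>

definition lab :: "nat set \<Rightarrow> nat \<Rightarrow> nat" where
  "lab A i = sorted_list_of_set A ! (i - 1)"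

text \<open>The class transported to an arbitrary finite set by the order-preserving enumeration.
  Deleting cycles then becomes restriction to a smaller set, without relabeling.\<close>

definition on_set :: "sized_perm set \<Rightarrow> nat set \<Rightarrow> (nat \<Rightarrow> nat) set" where
  "on_set C A = map_permutation {1..card A} (lab A) ` {\<tau>. (card A, \<tau>) \<in> C}"

lemma lab_strict_mono:
  assumes "finite A"
  shows "strict_mono_on {1..card A} (lab A)"
proof (rule strict_mono_onI)
  fix r s assume "r \<in> {1..card A}" "s \<in> {1..card A}" "r < s"
  then have "r - 1 < s - 1" "s - 1 < length (sorted_list_of_set A)" using assms by auto
  then show "lab A r < lab A s"
    unfolding lab_def using strict_sorted_list_of_set[of A] sorted_wrt_nth_less by blast
qed

lemma lab_bij:
  assumes "finite A"
  shows "bij_betw (lab A) {1..card A} A"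
proof -
  let ?xs = "sorted_list_of_set A"
  have "lab A ` {1..card A} = {?xs ! j | j. j < card A}"
  proof (intro equalityI subsetI)
    fix x assume "x \<in> {?xs ! j | j. j < card A}"
    then obtain j where "j < card A" "x = lab A (Suc j)" by (auto simp: lab_def)
    then show "x \<in> lab A ` {1..card A}" by auto
  next
    fix x assume "x \<in> lab A ` {1..card A}"
    then obtain i where "i \<in> {1..card A}" "x = ?xs ! (i - 1)" by (auto simp: lab_def)
    then have "i - 1 < card A \<and> x = ?xs ! (i - 1)" by auto
    then show "x \<in> {?xs ! j | j. j < card A}" by blast
  qed
  also have "\<dots> = A"
    using set_conv_nth[of ?xs] assms by simp
  finally have "lab A ` {1..card A} = A" .
  then show ?thesis
    using lab_strict_mono[OF assms] by (simp add: bij_betw_def strict_mono_on_imp_inj_on)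
qed

lemma lab_Icc: "i \<in> {1..n} \<Longrightarrow> lab {1..n} i = i"
  unfolding lab_def atLeastLessThanSuc_atLeastAtMost[symmetric]
  by (subst sorted_list_of_set_range) (auto simp del: upt_Suc)

lemma nxt_image:
  assumes "finite A" "a \<in> A" "strict_mono_on A f"
  shows "nxt (f ` A) (f a) = f (nxt A a)"
proof (rule nxt_eqI)
  have less: "f x < f y \<longleftrightarrow> x < y" and le: "f x \<le> f y \<longleftrightarrow> x \<le> y"
    if "x \<in> A" "y \<in> A" for x y
    using assms(3) that strict_mono_on_less strict_mono_on_less_eq by blast+
  have n: "nxt A a \<in> A" using nxt_in assms by blast
  then show "f (nxt A a) \<in> f ` A" by simp
  show "f a < f (nxt A a) \<and> f (nxt A a) \<le> b" if b: "b \<in> f ` A" "f a < b" for b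
  proof -
    from b obtain c where c: "c \<in> A" "b = f c" by blast
    then have "a < c" using b less assms by blast
    then have "a < nxt A a" "nxt A a \<le> c" using nxt_greater[OF assms(1)] c by blast+
    then show ?thesis using c less le n assms by blast
  qed
  show "f (nxt A a) \<le> b" if b: "b \<in> f ` A" "\<not> (\<exists>b\<in>f ` A. f a < b)" for b
  proof -
    from b obtain c where c: "c \<in> A" "b = f c" by blast
    have "\<not> (\<exists>c\<in>A. a < c)" using b less assms by blast
    then have "nxt A a \<le> c" using c assms by (simp add: nxt_Min)
    then show ?thesis using c le n by blast
  qed
qed (use assms in simp)

lemma orbit_map_permutation:
  assumes "inj_on f A" "\<tau> permutes A" "x \<in> A"
  shows "orbit (map_permutation A f \<tau>) (f x) = f ` orbit \<tau> x"
proof -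
  have sub: "orbit \<tau> x \<subseteq> A" using permutes_orbit_subset[OF assms(2,3)] .
  note app = map_permutation_apply[OF assms(1)]
  have "y \<in> f ` orbit \<tau> x" if "y \<in> orbit (map_permutation A f \<tau>) (f x)" for y
    using that
  proof induction
    case base
    then show ?case using app[OF assms(3)] by (auto intro: orbit.base)
  next
    case (step y)
    then obtain z where "z \<in> orbit \<tau> x" "y = f z" by blast
    then show ?case using app[of z] sub by (auto intro: orbit.step)
  qed
  moreover have "f y \<in> orbit (map_permutation A f \<tau>) (f x)" if "y \<in> orbit \<tau> x" for y
    using that
  proof induction
    case base
    then show ?case using app[OF assms(3), of \<tau>] orbit.base[of "map_permutation A f \<tau>" "f x"] by simp
  next
    case (step y)
    then show ?case using app[of y \<tau>] sub orbit.step[of "f y" "map_permutation A f \<tau>" "f x"] by auto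
  qed
  ultimately show ?thesis by blast
qed

text \<open>An increasing bijection commutes with cyclic successors and carries orbits to orbits, so
  arcs can be pulled back along it.\<close>

lemma arcs_map_permutation:
  assumes "bij_betw f {1..m} A" "strict_mono_on {1..m} f" "\<tau> permutes {1..m}"
    and "B \<in> arcs A (map_permutation {1..m} f \<tau>)"
  obtains B' where "B' \<in> arcs {1..m} \<tau>" "B = f ` B'" "B' \<subseteq> {1..m}"
proof -
  let ?\<sigma> = "map_permutation {1..m} f \<tau>"
  have inj: "inj_on f {1..m}" and im: "f ` {1..m} = A"
    using assms(1) by (auto simp: bij_betw_def)
  from assms(4) obtain x e where x: "x \<in> A" "B = orbit ?\<sigma> x" and e: "e \<in> B"
    and nx: "\<And>a. a \<in> B \<Longrightarrow> a \<noteq> e \<Longrightarrow> ?\<sigma> a = nxt A a"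
    unfolding arcs_def by blast
  from x im obtain y where y: "y \<in> {1..m}" "x = f y" by blast
  have B: "B = f ` orbit \<tau> y" using orbit_map_permutation[OF inj assms(3) y(1)] x y by simp
  have sub: "orbit \<tau> y \<subseteq> {1..m}" using permutes_orbit_subset[OF assms(3) y(1)] .
  from e B obtain e' where e': "e' \<in> orbit \<tau> y" "e = f e'" by blast
  have "\<tau> a = nxt {1..m} a" if a: "a \<in> orbit \<tau> y" "a \<noteq> e'" for a
  proof -
    have am: "a \<in> {1..m}" using a sub by blast
    have "f a \<noteq> e" using a e' sub inj by (meson inj_onD subsetD)
    then have "f (\<tau> a) = nxt A (f a)"
      using nx[of "f a"] a B map_permutation_apply[OF inj am, of \<tau>] by auto
    also have "\<dots> = f (nxt {1..m} a)"
      using nxt_image[of "{1..m}" a f] am assms(2) im by simp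
    finally show ?thesis
      using inj am permutes_in_image[OF assms(3)] nxt_in[of "{1..m}" a]
      by (metis empty_iff finite_atLeastAtMost inj_onD)
  qed
  then have "orbit \<tau> y \<in> arcs {1..m} \<tau>"
    unfolding arcs_def using y e' by blast
  then show thesis using that B sub by blast
qed

lemma on_set_iff:
  assumes "finite A" "perm_class C" "\<tau> permutes {1..card A}"
  shows "map_permutation {1..card A} (lab A) \<tau> \<in> on_set C A \<longleftrightarrow> (card A, \<tau>) \<in> C"
proof
  note bij = lab_bij[OF assms(1)]
  assume "map_permutation {1..card A} (lab A) \<tau> \<in> on_set C A"
  then obtain \<tau>' where \<tau>': "(card A, \<tau>') \<in> C"
    and eq: "map_permutation {1..card A} (lab A) \<tau> = map_permutation {1..card A} (lab A) \<tau>'"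
    unfolding on_set_def by blast
  have "\<tau>' permutes {1..card A}" using \<tau>' assms(2) by (auto simp: perm_class_def)
  then have "\<tau>' = \<tau>"
    using eq map_permutation_compose_inv[OF bij assms(3), of "inv_into {1..card A} (lab A)"]
      map_permutation_compose_inv[OF bij, of \<tau>' "inv_into {1..card A} (lab A)"]
      bij_betw_inv_into_left[OF bij] by metis
  then show "(card A, \<tau>) \<in> C" using \<tau>' by simp
qed (auto simp: on_set_def)

lemma permutes_relabel:
  assumes "finite A" "\<sigma> permutes A"
  obtains \<tau> where "\<tau> permutes {1..card A}" "\<sigma> = map_permutation {1..card A} (lab A) \<tau>"
proof
  let ?g = "inv_into {1..card A} (lab A)"
  note bij = lab_bij[OF assms(1)]
  show "map_permutation A ?g \<sigma> permutes {1..card A}"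
    by (rule map_permutation_permutes[OF bij_betw_inv_into[OF bij] assms(2)])
  show "\<sigma> = map_permutation {1..card A} (lab A) (map_permutation A ?g \<sigma>)"
    using map_permutation_compose_inv[OF bij_betw_inv_into[OF bij] assms(2), of "lab A"]
      bij_betw_inv_into_right[OF bij] by simp
qed

lemma on_set_permutes:
  "finite A \<Longrightarrow> perm_class C \<Longrightarrow> \<sigma> \<in> on_set C A \<Longrightarrow> \<sigma> permutes A"
  unfolding on_set_def perm_class_def
  by (auto intro!: map_permutation_permutes lab_bij)

lemma on_set_Icc:
  assumes "perm_class C"
  shows "on_set C {1..n} = {\<pi>. (n, \<pi>) \<in> C}"
proof -
  have "map_permutation {1..n} (lab {1..n}) \<pi> = \<pi>" if "(n, \<pi>) \<in> C" for \<pi>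
  proof -
    have p: "\<pi> permutes {1..n}" using that assms by (auto simp: perm_class_def)
    have "map_permutation {1..n} (lab {1..n}) \<pi> = map_permutation {1..n} id \<pi>"
      using lab_bij[of "{1..n}"] p by (intro map_permutation_cong) (auto simp: lab_Icc bij_betw_def)
    then show ?thesis using p by simp
  qed
  then have "map_permutation {1..n} (lab {1..n}) ` {\<pi>. (n, \<pi>) \<in> C} = id ` {\<pi>. (n, \<pi>) \<in> C}"
    by (intro image_cong) auto
  then show ?thesis by (simp add: on_set_def)
qed

lemma finite_on_set: "finite A \<Longrightarrow> perm_class C \<Longrightarrow> finite (on_set C A)"
  by (rule finite_subset[OF _ finite_permutations[of A]]) (auto dest: on_set_permutes)

subsection \<open>Removing arcs\<close>

lemma finite_arcs: "finite A \<Longrightarrow> finite (arcs A \<sigma>)"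
  unfolding arcs_def by simp

lemma arcs_eq_orbit:
  assumes "\<sigma> permutes A" "finite A" "B \<in> arcs A \<sigma>" "x \<in> B"
  shows "B = orbit \<sigma> x"
proof -
  from assms(3) obtain y where "B = orbit \<sigma> y" unfolding arcs_def by blast
  then show ?thesis using permutes_orbit_eq[OF assms(1,2), of x y] assms(4) by simp
qed

lemma arcs_subset: "\<sigma> permutes A \<Longrightarrow> B \<in> arcs A \<sigma> \<Longrightarrow> B \<subseteq> A"
  by (auto simp: arcs_def dest: permutes_orbit_subset)

lemma arcs_step_iff:
  assumes "\<sigma> permutes A" "finite A" "B \<in> arcs A \<sigma>"
  shows "\<sigma> x \<in> B \<longleftrightarrow> x \<in> B"
proof
  assume "\<sigma> x \<in> B"
  then have "B = orbit \<sigma> (\<sigma> x)" by (rule arcs_eq_orbit[OF assms])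
  also have "\<dots> = orbit \<sigma> x" by (rule permutes_orbit_eq[OF assms(1,2) orbit.base])
  finally show "x \<in> B" using permutes_self_in_orbit[OF assms(1,2)] by simp
next
  assume "x \<in> B"
  then show "\<sigma> x \<in> B" using arcs_eq_orbit[OF assms] orbit.base by metis
qed

lemma perm_restrict_permutes:
  assumes "\<sigma> permutes A" "finite K" "\<sigma> ` K \<subseteq> K"
  shows "perm_restrict \<sigma> K permutes K"
proof -
  have inj: "inj_on \<sigma> K"
    using permutes_inj[OF assms(1)] inj_on_subset by blast
  then have "bij_betw \<sigma> K K"
    using endo_inj_surj[OF assms(2,3)] by (simp add: bij_betw_def)
  then have "bij_betw (perm_restrict \<sigma> K) K K"
    by (subst bij_betw_cong[of K _ \<sigma>]) (simp_all add: perm_restrict_simps)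
  then show ?thesis by (rule bij_imp_permutes) (simp add: perm_restrict_simps)
qed

text \<open>After relabeling, the two permutations form a trivial reduction. Closure under
  extensions gives one direction and closure under reductions the other.\<close>

lemma on_set_remove_arc:
  assumes "perm_class C" "closed_under_trivial_reductions C" "closed_under_trivial_extensions C"
    and "finite A" "\<sigma> permutes A" "B \<in> arcs A \<sigma>"
  shows "perm_restrict \<sigma> (A - B) \<in> on_set C (A - B) \<longleftrightarrow> \<sigma> \<in> on_set C A"
proof -
  let ?A = "A - B" and ?m = "card A" and ?m' = "card (A - B)"
  have finA: "finite ?A" using assms(4) by simp
  note bij = lab_bij[OF assms(4)] and mono = lab_strict_mono[OF assms(4)]
  note bij' = lab_bij[OF finA] and mono' = lab_strict_mono[OF finA]
  obtain \<tau> where \<tau>: "\<tau> permutes {1..?m}" "\<sigma> = map_permutation {1..?m} (lab A) \<tau>"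
    using permutes_relabel[OF assms(4,5)] .
  have "\<sigma> ` ?A \<subseteq> ?A"
    using arcs_step_iff[OF assms(5,4,6)] permutes_in_image[OF assms(5)] by auto
  then have p': "perm_restrict \<sigma> ?A permutes ?A"
    by (rule perm_restrict_permutes[OF assms(5) finA])
  obtain \<tau>' where \<tau>': "\<tau>' permutes {1..?m'}"
    "perm_restrict \<sigma> ?A = map_permutation {1..?m'} (lab ?A) \<tau>'"
    using permutes_relabel[OF finA p'] .
  obtain B' where B': "B' \<in> arcs {1..?m} \<tau>" "B = lab A ` B'" "B' \<subseteq> {1..?m}"
    using arcs_map_permutation[OF bij mono \<tau>(1)] assms(6) \<tau>(2) by blast
  obtain cs where cs: "trivial_cycle ?m \<tau> cs" "set cs = B'"
    using arc_imp_trivial_cycle[OF \<tau>(1) B'(1)] by blast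
  have inj: "inj_on (lab A) {1..?m}" using bij by (simp add: bij_betw_def)
  have "lab A ` ({1..?m} - B') = ?A"
    using bij inj_on_image_set_diff[OF inj, of "{1..?m}" B'] B' by (simp add: bij_betw_def)
  then have bijB: "bij_betw (lab A) ({1..?m} - B') ?A"
    using bij_betw_subset[OF bij, of "{1..?m} - B'"] by auto
  \<comment> \<open>The comparison of the two enumerations; it serves as the map \<open>f\<close> in
    \<open>trivial_reduction\<close>.\<close>
  define g where "g = inv_into ({1..?m} - B') (lab A) \<circ> lab ?A"
  have g: "bij_betw g {1..?m'} ({1..?m} - B')"
    unfolding g_def by (rule bij_betw_trans[OF bij' bij_betw_inv_into[OF bijB]])
  have lab_g: "lab A (g i) = lab ?A i" if "i \<in> {1..?m'}" for i
    using bij_betw_inv_into_right[OF bijB] bij_betwE[OF bij'] that by (simp add: g_def)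
  have g_in: "g i \<in> {1..?m}" if "i \<in> {1..?m'}" for i
    using bij_betwE[OF g] that by blast
  have "strict_mono_on {1..?m'} g"
  proof (rule strict_mono_onI)
    fix r s assume rs: "r \<in> {1..?m'}" "s \<in> {1..?m'}" "r < s"
    then have "lab A (g r) < lab A (g s)" using lab_g mono' by (metis strict_mono_onD)
    then show "g r < g s" using strict_mono_on_less[OF mono] g_in rs by blast
  qed
  moreover have "g (\<tau>' i) = \<tau> (g i)" if i: "i \<in> {1..?m'}" for i
  proof -
    have \<tau>i: "\<tau>' i \<in> {1..?m'}" using i permutes_in_image[OF \<tau>'(1)] by blast
    have Ai: "lab ?A i \<in> ?A" using bij_betwE[OF bij'] i by blast
    have "lab A (g (\<tau>' i)) = lab ?A (\<tau>' i)" by (rule lab_g[OF \<tau>i])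
    also have "\<dots> = perm_restrict \<sigma> ?A (lab ?A i)"
      unfolding \<tau>'(2) using bij' i by (simp add: map_permutation_apply bij_betw_def)
    also have "\<dots> = \<sigma> (lab A (g i))"
      using Ai lab_g[OF i] by (simp add: perm_restrict_def)
    also have "\<dots> = lab A (\<tau> (g i))"
      unfolding \<tau>(2) by (rule map_permutation_apply[OF inj g_in[OF i]])
    finally show ?thesis
      using inj g_in[OF \<tau>i] g_in[OF i] permutes_in_image[OF \<tau>(1)] by (metis inj_onD)
  qed
  ultimately have "trivial_reduction (?m, \<tau>) (?m', \<tau>')"
    unfolding trivial_reduction_def prod.case using \<tau>(1) \<tau>'(1) cs g
    by (intro conjI exI[of _ cs] exI[of _ g]) auto
  then have "(?m', \<tau>') \<in> C \<longleftrightarrow> (?m, \<tau>) \<in> C"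
    using assms(2,3) unfolding closed_under_trivial_reductions_def
      closed_under_trivial_extensions_def by blast
  then show ?thesis
    using on_set_iff[OF assms(4,1) \<tau>(1)] on_set_iff[OF finA assms(1) \<tau>'(1)] \<tau>(2) \<tau>'(2) by simp
qed

lemma remove_arcs_permutes:
  assumes "\<sigma> permutes A" "finite A" "S \<subseteq> arcs A \<sigma>"
  shows "\<sigma> ` (A - \<Union>S) \<subseteq> A - \<Union>S" "perm_restrict \<sigma> (A - \<Union>S) permutes A - \<Union>S"
proof -
  show *: "\<sigma> ` (A - \<Union>S) \<subseteq> A - \<Union>S"
    using arcs_step_iff[OF assms(1,2)] permutes_in_image[OF assms(1)] assms(3) by blast
  show "perm_restrict \<sigma> (A - \<Union>S) permutes A - \<Union>S"
    using perm_restrict_permutes[OF assms(1) _ *] assms(2) by simp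
qed

text \<open>Arcs are orbits, so distinct ones are disjoint and \<open>B\<close> survives. Its
  successor steps stay in \<open>B\<close> and remain successor steps in the smaller set by
  \<open>nxt_subset\<close>.\<close>

lemma arcs_remove_arcs:
  assumes "\<sigma> permutes A" "finite A" "S \<subseteq> arcs A \<sigma>" "B \<in> arcs A \<sigma>" "B \<notin> S"
  shows "B \<in> arcs (A - \<Union>S) (perm_restrict \<sigma> (A - \<Union>S))"
proof -
  let ?A = "A - \<Union>S" and ?\<sigma> = "perm_restrict \<sigma> (A - \<Union>S)"
  from assms(4) obtain x e where x: "x \<in> A" "B = orbit \<sigma> x" and e: "e \<in> B"
    and nx: "\<And>a. a \<in> B \<Longrightarrow> a \<noteq> e \<Longrightarrow> \<sigma> a = nxt A a"
    unfolding arcs_def by blast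
  have "z \<notin> \<Union>S" if "z \<in> B" for z
    using arcs_eq_orbit[OF assms(1,2,4) that] arcs_eq_orbit[OF assms(1,2), of _ z] assms(3,5)
    by (metis UnionE subsetD)
  then have BA: "B \<subseteq> ?A" using arcs_subset[OF assms(1,4)] by blast
  have xA: "x \<in> ?A" using BA x(2) permutes_self_in_orbit[OF assms(1,2)] by blast
  have "orbit \<sigma> x = orbit ?\<sigma> x"
    using remove_arcs_permutes(1)[OF assms(1-3)] xA
    by (intro orbit_cong0[of x ?A]) (auto simp: perm_restrict_def)
  moreover have "?\<sigma> a = nxt ?A a" if a: "a \<in> B" "a \<noteq> e" for a
  proof -
    have "\<sigma> a \<in> B" using arcs_step_iff[OF assms(1,2,4)] a by blast
    then have "nxt ?A a = nxt A a"
      using nx[OF a] BA a by (intro nxt_subset[OF assms(2)]) auto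
    then show ?thesis using nx[OF a] a BA by (auto simp: perm_restrict_def)
  qed
  ultimately show ?thesis
    unfolding arcs_def using x(2) xA e by blast
qed

text \<open>Deleting the arcs one at a time is possible because the remaining ones stay arcs. The
  equivalence lets the permutation on the kept points range over the whole transported
  class.\<close>

lemma on_set_remove_arcs:
  assumes "perm_class C" "closed_under_trivial_reductions C" "closed_under_trivial_extensions C"
    and "finite A" "\<sigma> permutes A" "S \<subseteq> arcs A \<sigma>"
  shows "perm_restrict \<sigma> (A - \<Union>S) \<in> on_set C (A - \<Union>S) \<longleftrightarrow> \<sigma> \<in> on_set C A"
proof -
  have "finite S" using finite_arcs[OF assms(4)] assms(6) finite_subset by blast
  then show ?thesis using assms(6)
  proof (induction S)
    case empty
    then show ?case using assms(5) by simp
  next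
    case (insert B S)
    let ?A = "A - \<Union>S" and ?\<sigma> = "perm_restrict \<sigma> (A - \<Union>S)"
    have S: "S \<subseteq> arcs A \<sigma>" and B: "B \<in> arcs A \<sigma>" using insert.prems by auto
    have "perm_restrict ?\<sigma> (?A - B) \<in> on_set C (?A - B) \<longleftrightarrow> ?\<sigma> \<in> on_set C ?A"
      using assms(4) remove_arcs_permutes(2)[OF assms(5,4) S]
        arcs_remove_arcs[OF assms(5,4) S B insert.hyps(2)]
      by (intro on_set_remove_arc[OF assms(1-3)]) auto
    moreover have "?A - B = A - \<Union>(insert B S)" by blast
    moreover have "perm_restrict ?\<sigma> (?A - B) = perm_restrict \<sigma> (?A - B)"
      by (auto simp: perm_restrict_def)
    ultimately show ?case using insert.IH[OF S] by simp
  qed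
qed

subsection \<open>Permutations with prescribed arcs\<close>

text \<open>
  The cycles of this permutation are the cyclic intervals of \<open>{1..n}\<close> that end at the elements
  of \<open>Z\<close>.
\<close>

definition arc_perm :: "nat \<Rightarrow> nat set \<Rightarrow> nat \<Rightarrow> nat" where
  "arc_perm n Z = rot {1..n} \<circ> inv (rot Z)"

text \<open>
  \<open>K\<close> is the set of kept points and \<open>E\<close> the set of ends of the removed arcs. A point in front of a
  kept point has to be an end. If nothing is kept and all points form one arc, then this arc has no
  end.
\<close>

definition config :: "nat \<Rightarrow> nat set \<Rightarrow> nat set \<Rightarrow> bool" where
  "config n K E \<longleftrightarrow> K \<subseteq> {1..n} \<and> E \<subseteq> {1..n} - K \<and>
     (\<forall>a\<in>{1..n} - K. nxt {1..n} a \<in> K \<longrightarrow> a \<in> E) \<and> (K = {} \<longrightarrow> card E \<noteq> 1)"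

lemma arc_perm_notin:
  assumes "finite Z" "a \<in> {1..n} - Z"
  shows "arc_perm n Z a = nxt {1..n} a"
  using assms permutes_not_in[OF permutes_inv[OF rot_permutes[OF assms(1)]], of a]
  by (simp add: arc_perm_def rot_def)

text \<open>The inverse of \<open>rot Z\<close> steps from an interval end back to the preceding end
  \<open>t\<close>; the rotation then moves on to the point after \<open>t\<close>, which is where
  the interval begins.\<close>

lemma arc_perm_nxt:
  assumes "Z \<subseteq> {1..n}" "t \<in> Z"
  shows "arc_perm n Z (nxt Z t) = nxt {1..n} t"
proof -
  have "finite Z" using assms(1) finite_subset by blast
  then have "inv (rot Z) (rot Z t) = t" by (rule permutes_inverses(2)[OF rot_permutes])
  then show ?thesis using assms by (auto simp: arc_perm_def rot_def)
qed

lemma nxt_surj: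
  assumes "finite A" "a \<in> A"
  obtains t where "t \<in> A" "nxt A t = a"
proof -
  have "a \<in> rot A ` A" using permutes_image[OF rot_permutes[OF assms(1)]] assms(2) by simp
  then show thesis using that by (auto simp: rot_def)
qed

lemma arc_perm_permutes:
  assumes "Z \<subseteq> {1..n}"
  shows "arc_perm n Z permutes {1..n}"
proof -
  have "finite Z" using assms finite_subset by blast
  then show ?thesis
    unfolding arc_perm_def using assms
    by (intro permutes_compose permutes_subset[OF permutes_inv[OF rot_permutes]] rot_permutes) auto
qed

text \<open>The invariant that confines each cycle to one interval: an end returns to the start of
  its own interval, and any other point moves one step towards the same end.\<close>

lemma ahead_arc_perm:
  assumes "Z \<subseteq> {1..n}" "Z \<noteq> {}" "a \<in> {1..n}"
  shows "ahead Z (arc_perm n Z a) = ahead Z a"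
proof -
  have fin: "finite Z" using assms(1) finite_subset by blast
  show ?thesis
  proof (cases "a \<in> Z")
    case True
    then obtain t where t: "t \<in> Z" "nxt Z t = a" using nxt_surj[OF fin] by blast
    then have "arc_perm n Z a = nxt {1..n} t" using arc_perm_nxt[OF assms(1)] by blast
    then show ?thesis
      using ahead_nxt_Icc[OF assms(1,2), of t] t assms(1) True by (auto simp: ahead_def)
  next
    case False
    then show ?thesis
      using arc_perm_notin[OF fin, of a n] ahead_nxt_Icc[OF assms] assms(3) by (simp add: ahead_def)
  qed
qed

context
  fixes n K E
  assumes config: "config n K E"
begin

lemma config_sets: "K \<union> E \<subseteq> {1..n}" "finite (K \<union> E)" "K \<inter> E = {}"
  using config by (auto simp: config_def intro: finite_subset)

text \<open>The point in front of a kept point is itself kept or a forced end, so the interval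
  ending at a kept point is a singleton.\<close>

lemma arc_perm_kept:
  assumes "k \<in> K"
  shows "arc_perm n (K \<union> E) k = k"
proof -
  have kn: "k \<in> {1..n}" using assms config_sets by blast
  obtain t where t: "t \<in> {1..n}" "nxt {1..n} t = k" using nxt_surj[OF _ kn] by auto
  then have tZ: "t \<in> K \<union> E" using config assms by (auto simp: config_def)
  then have "nxt (K \<union> E) t = k"
    using nxt_subset[OF _ config_sets(1) t(1)] assms t(2) by simp
  then show ?thesis using arc_perm_nxt[OF config_sets(1) tZ] t by simp
qed

lemma arc_perm_removed:
  assumes "a \<in> {1..n} - K"
  shows "arc_perm n (K \<union> E) a \<in> {1..n} - K"
proof -
  note p = arc_perm_permutes[OF config_sets(1)]
  have "arc_perm n (K \<union> E) a \<notin> K"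
    using arc_perm_kept[of "arc_perm n (K \<union> E) a"] permutes_inj[OF p] assms
    by (metis DiffD2 injD)
  then show ?thesis using permutes_in_image[OF p] assms by blast
qed

text \<open>If an end \<open>a\<close> went to its successor, the element of
  \<open>K \<union> E\<close> preceding \<open>a\<close> would have the same successor and hence be
  \<open>a\<close>. Then \<open>K \<union> E = {a}\<close>, which is what the condition
  \<open>card E \<noteq> 1\<close> for empty \<open>K\<close> excludes.\<close>

lemma arc_perm_ends: "{a \<in> {1..n} - K. arc_perm n (K \<union> E) a \<noteq> nxt {1..n} a} = E"
proof -
  let ?Z = "K \<union> E"
  have "arc_perm n ?Z a \<noteq> nxt {1..n} a" if a: "a \<in> E" for a
  proof
    assume eq: "arc_perm n ?Z a = nxt {1..n} a"
    obtain t where t: "t \<in> ?Z" "nxt ?Z t = a" using nxt_surj[OF config_sets(2)] a by blast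
    then have "nxt {1..n} t = nxt {1..n} a" using arc_perm_nxt[OF config_sets(1)] eq by metis
    then have "t = a"
      using inj_on_nxt[of "{1..n}"] t a config_sets(1) by (meson UnI2 finite_atLeastAtMost inj_onD subsetD)
    then have "?Z = {a}" using nxt_self[OF config_sets(2) t(1)] t(2) by simp
    then have "K \<subseteq> {a}" "E \<subseteq> {a}" by (metis sup_ge1, metis sup_ge2)
    moreover have "a \<notin> K" using a config_sets(3) by (metis IntI empty_iff)
    ultimately have "K = {}" "E = {a}" using a by auto
    then have "K = {}" "card E = 1" by simp_all
    then show False using config by (simp add: config_def)
  qed
  moreover have "arc_perm n ?Z a = nxt {1..n} a" if "a \<in> {1..n} - K" "a \<notin> E" for a
    using that arc_perm_notin[OF config_sets(2)] by blast
  moreover have "E \<subseteq> {1..n} - K" using config by (simp add: config_def)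
  ultimately show ?thesis by blast
qed

lemma orbit_arc_perm_subset:
  assumes "a \<in> {1..n} - K"
  shows "orbit (arc_perm n (K \<union> E)) a \<subseteq> {1..n} - K"
proof
  fix x assume "x \<in> orbit (arc_perm n (K \<union> E)) a"
  then show "x \<in> {1..n} - K"
    by induction (use assms arc_perm_removed in blast)+
qed

lemma ahead_orbit_arc_perm:
  assumes "K \<union> E \<noteq> {}" "a \<in> {1..n} - K" "x \<in> orbit (arc_perm n (K \<union> E)) a"
  shows "ahead (K \<union> E) x = ahead (K \<union> E) a"
  using assms(3)
proof induction
  case base
  then show ?case using ahead_arc_perm[OF config_sets(1) assms(1)] assms(2) by blast
next
  case (step y)
  then have "y \<in> {1..n}" using orbit_arc_perm_subset[OF assms(2)] by blast
  then show ?case using ahead_arc_perm[OF config_sets(1) assms(1)] step.IH by metis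
qed

text \<open>\<open>ahead\<close> is constant on the orbit and fixes every end, so the orbit contains
  at most one end. All other points take successor steps.\<close>

lemma orbit_arc_perm_is_arc:
  assumes "a \<in> {1..n} - K"
  shows "\<exists>e\<in>orbit (arc_perm n (K \<union> E)) a. \<forall>x\<in>orbit (arc_perm n (K \<union> E)) a - {e}.
    arc_perm n (K \<union> E) x = nxt {1..n} x"
proof (cases "orbit (arc_perm n (K \<union> E)) a \<inter> E = {}")
  case True
  have "arc_perm n (K \<union> E) x = nxt {1..n} x" if "x \<in> orbit (arc_perm n (K \<union> E)) a" for x
    using that True orbit_arc_perm_subset[OF assms] arc_perm_notin[OF config_sets(2), of x n] by blast
  then show ?thesis using orbit.base[of "arc_perm n (K \<union> E)" a] by blast
next
  case False
  then obtain e where e: "e \<in> orbit (arc_perm n (K \<union> E)) a" "e \<in> E" by blast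
  then have ne: "K \<union> E \<noteq> {}" by blast
  have "arc_perm n (K \<union> E) x = nxt {1..n} x"
    if x: "x \<in> orbit (arc_perm n (K \<union> E)) a" "x \<noteq> e" for x
  proof -
    have "ahead (K \<union> E) x = ahead (K \<union> E) e"
      using ahead_orbit_arc_perm[OF ne assms] e x by metis
    then have "x \<notin> E" using e x by (auto simp: ahead_def)
    then show ?thesis
      using x orbit_arc_perm_subset[OF assms] arc_perm_notin[OF config_sets(2), of x n] by blast
  qed
  then show ?thesis using e by blast
qed

text \<open>Each orbit contains exactly one end, except when \<open>K \<union> E\<close> is empty
  and the permutation is the rotation of the whole circle. An orbit without an end is closed under
  successors and therefore is the whole circle.\<close>

lemma card_orbits_arc_perm:
  assumes "n \<ge> 1"
  shows "card (orbit (arc_perm n (K \<union> E)) ` ({1..n} - K)) = (if K \<union> E = {} then 1 else card E)"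
proof -
  let ?b = "arc_perm n (K \<union> E)"
  note p = arc_perm_permutes[OF config_sets(1)]
  have full: "orbit ?b a = {1..n}" if a: "a \<in> {1..n} - K" "orbit ?b a \<inter> E = {}" for a
  proof (rule nxt_closed_Icc)
    show "a \<in> orbit ?b a" by (rule permutes_self_in_orbit[OF p]) simp
    show "orbit ?b a \<subseteq> {1..n}" using orbit_arc_perm_subset[OF a(1)] by blast
    show "nxt {1..n} x \<in> orbit ?b a" if x: "x \<in> orbit ?b a" for x
    proof -
      have "?b x = nxt {1..n} x"
        using x a orbit_arc_perm_subset[OF a(1)] arc_perm_notin[OF config_sets(2), of x n] by blast
      then show ?thesis using orbit.step[OF x] by simp
    qed
  qed
  show ?thesis
  proof (cases "K \<union> E = {}")
    case True
    then have "orbit ?b ` ({1..n} - K) = {{1..n}}" using full assms by auto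
    then show ?thesis using True by simp
  next
    case False
    have "orbit ?b a \<in> orbit ?b ` E" if a: "a \<in> {1..n} - K" for a
    proof (cases "orbit ?b a \<inter> E = {}")
      case True
      then have "K = {}" "E = {}"
        using full[OF a] orbit_arc_perm_subset[OF a] config_sets by blast+
      then show ?thesis using False by simp
    next
      case False
      then obtain e where "e \<in> orbit ?b a" "e \<in> E" by blast
      then show ?thesis using permutes_orbit_eq[OF p, of e a] by auto
    qed
    then have "orbit ?b ` ({1..n} - K) = orbit ?b ` E"
      using config by (auto simp: config_def)
    moreover have "inj_on (orbit ?b) E"
    proof (rule inj_onI)
      fix x y assume xy: "x \<in> E" "y \<in> E" "orbit ?b x = orbit ?b y"
      then have "x \<in> {1..n} - K" "y \<in> {1..n} - K" using config by (auto simp: config_def)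
      moreover have "y \<in> orbit ?b x" using xy permutes_self_in_orbit[OF p] by simp
      ultimately have "ahead (K \<union> E) y = ahead (K \<union> E) x"
        using ahead_orbit_arc_perm[OF False] by blast
      then show "x = y" using xy by (simp add: ahead_def)
    qed
    ultimately show ?thesis using False by (simp add: card_image)
  qed
qed

end

text \<open>Only an end \<open>a\<close> needs an argument. Following its cycle from
  \<open>\<pi> a\<close> back to \<open>a\<close> meets no other element of
  \<open>K \<union> E\<close> on the way, so \<open>a\<close> is the first one at or after
  \<open>\<pi> a\<close>. The point before \<open>\<pi> a\<close> lies in
  \<open>K \<union> E\<close> by injectivity, which makes \<open>\<pi> a\<close> the start of the
  interval ending at \<open>a\<close>.\<close>

lemma arcs_determine:
  assumes "\<pi> permutes {1..n}" "S \<subseteq> arcs {1..n} \<pi>" "K = {1..n} - \<Union>S"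
    and "E = {a \<in> {1..n} - K. \<pi> a \<noteq> nxt {1..n} a}" and a: "a \<in> {1..n} - K"
  shows "\<pi> a = arc_perm n (K \<union> E) a"
proof (cases "a \<in> E")
  case False
  have "finite (K \<union> E)" using assms(3,4) by auto
  then show ?thesis using False a assms(4) arc_perm_notin[of "K \<union> E" a n] by auto
next
  case True
  let ?Z = "K \<union> E"
  have Z: "?Z \<subseteq> {1..n}" "?Z \<noteq> {}" using assms(3,4) True by auto
  have fin: "finite {1..n}" by simp
  have U: "\<Union>S \<subseteq> {1..n}" using arcs_subset[OF assms(1)] assms(2) by blast
  then obtain B where B: "B \<in> S" "a \<in> B" using a assms(3) by blast
  then have Ba: "B \<in> arcs {1..n} \<pi>" using assms(2) by blast
  have BK: "B \<inter> K = {}" "B \<subseteq> {1..n}" using B assms(3) U by auto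
  obtain e where e: "e \<in> B" "\<And>x. x \<in> B \<Longrightarrow> x \<noteq> e \<Longrightarrow> \<pi> x = nxt {1..n} x"
    using Ba unfolding arcs_def by blast
  have "e = a" using e B True assms(4) by blast
  then have nx: "x \<notin> ?Z" "\<pi> x = nxt {1..n} x" if "x \<in> B" "x \<noteq> a" for x
    using e(2)[of x] that BK assms(4) by auto
  have step: "ahead ?Z (\<pi> x) = ahead ?Z x" if "x \<in> B" "x \<noteq> a" for x
    using nx[OF that] ahead_nxt_Icc[OF Z, of x] that BK by (auto simp: ahead_def)
  have sB: "\<pi> a \<in> B" using arcs_step_iff[OF assms(1) fin Ba] B by blast
  \<comment> \<open>The second alternative holds from the moment the walk has passed
    \<open>a\<close>, where the step is no longer a successor step.\<close>
  have inv: "x \<in> B \<and> (ahead ?Z x = ahead ?Z (\<pi> a) \<or> ahead ?Z (\<pi> a) = a)"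
    if "x \<in> orbit \<pi> (\<pi> a)" for x
    using that
  proof induction
    case base
    then show ?case
      using sB step arcs_step_iff[OF assms(1) fin Ba] True by (cases "\<pi> a = a") (auto simp: ahead_def)
  next
    case (step x)
    then show ?case
      using \<open>\<And>x. x \<in> B \<Longrightarrow> x \<noteq> a \<Longrightarrow> ahead ?Z (\<pi> x) = ahead ?Z x\<close>[of x]
        arcs_step_iff[OF assms(1) fin Ba] True by (cases "x = a") (auto simp: ahead_def)
  qed
  have "a \<in> orbit \<pi> (\<pi> a)"
    using arcs_eq_orbit[OF assms(1) fin Ba sB] B by blast
  then have s: "ahead ?Z (\<pi> a) = a" using inv[of a] True by (auto simp: ahead_def)
  obtain t where t: "t \<in> {1..n}" "nxt {1..n} t = \<pi> a"
    using nxt_surj[OF fin, of "\<pi> a"] sB BK by blast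
  have tZ: "t \<in> ?Z"
  proof (rule ccontr)
    assume "t \<notin> ?Z"
    then have "\<pi> t = \<pi> a" using t assms(4) by auto
    then show False using permutes_inj[OF assms(1)] True \<open>t \<notin> ?Z\<close> by (auto dest: injD)
  qed
  have "nxt ?Z t = a" using ahead_nxt_Icc[OF Z t(1)] t(2) s by simp
  then show ?thesis using arc_perm_nxt[OF Z(1) tZ] t by simp
qed

text \<open>Removed points are mapped to removed points, so one in front of a kept point takes no
  successor step. If nothing is kept, \<pi> cannot differ from the rotation at exactly one point,
  because both are bijections.\<close>

lemma arcs_config:
  assumes "\<pi> permutes {1..n}" "S \<subseteq> arcs {1..n} \<pi>" "K = {1..n} - \<Union>S"
    and "E = {a \<in> {1..n} - K. \<pi> a \<noteq> nxt {1..n} a}"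
  shows "config n K E"
proof -
  have fin: "finite {1..n}" by simp
  have U: "\<Union>S \<subseteq> {1..n}" using arcs_subset[OF assms(1)] assms(2) by blast
  have "\<pi> a \<notin> K" if a: "a \<in> {1..n} - K" for a
  proof -
    obtain B where B: "B \<in> S" "a \<in> B" using a assms(3) by blast
    then have "B \<in> arcs {1..n} \<pi>" using assms(2) by blast
    then have "\<pi> a \<in> B" using arcs_step_iff[OF assms(1) fin, of B a] B(2) by simp
    then show ?thesis unfolding assms(3) using B(1) by auto
  qed
  then have "a \<in> E" if "a \<in> {1..n} - K" "nxt {1..n} a \<in> K" for a
    unfolding assms(4) using that by (metis (mono_tags, lifting) mem_Collect_eq)
  moreover have "card E \<noteq> 1" if K: "K = {}"
  proof
    assume "card E = 1"
    then obtain e where E: "E = {e}" using card_1_singletonE by blast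
    then have e: "e \<in> {1..n}" "\<pi> e \<noteq> nxt {1..n} e" using assms(4) by auto
    have "nxt {1..n} e \<in> {1..n}" using e(1) by (intro nxt_in) auto
    then obtain x where x: "x \<in> {1..n}" "\<pi> x = nxt {1..n} e"
      using permutes_image[OF assms(1)] by (metis imageE)
    then have "x \<noteq> e" using e(2) by metis
    then have "x \<in> {1..n} - K - E" using x(1) E K by simp
    then have "\<pi> x = nxt {1..n} x" unfolding assms(4) by auto
    then show False
      using x e(1) \<open>x \<noteq> e\<close> inj_on_nxt[OF fin] by (metis inj_onD)
  qed
  moreover have "K \<subseteq> {1..n}" unfolding assms(3) by blast
  moreover have "E \<subseteq> {1..n} - K" unfolding assms(4) by blast
  ultimately show ?thesis unfolding config_def by blast
qed

subsection \<open>Counting\<close>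

lemma alternating_sum_Pow:
  assumes "finite T"
  shows "(\<Sum>S\<in>Pow T. (- 1) ^ card S) = (if T = {} then 1 else 0 :: 'a::comm_ring_1)"
proof -
  have "(\<Sum>S\<in>Pow T. (- 1) ^ card S) = (\<Prod>t\<in>T. (- 1) + (1::'a))"
    using prod_add[OF assms, of "\<lambda>_. - 1 :: 'a" "\<lambda>_. 1"] by simp
  then show ?thesis
    using assms by (simp add: card_gt_0_iff power_0_left)
qed

section \<open>Coefficients of the generating functions as sums over permutations\<close>

lemma sum_fps_X_power:
  assumes "finite S"
  shows "(\<Sum>x\<in>S. fps_X ^ f x) = Abs_fps (\<lambda>k. real (card {x \<in> S. f x = k}))"
proof (rule fps_ext)
  fix k
  have "fps_nth (\<Sum>x\<in>S. fps_X ^ f x) k = (\<Sum>x\<in>S. if f x = k then 1 else 0 :: real)"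
    unfolding fps_sum_nth by (intro sum.cong) (auto simp: fps_X_power_nth)
  also have "\<dots> = real (card {x \<in> S. f x = k})"
    using assms by (simp add: sum.inter_filter[symmetric])
  finally show "fps_nth (\<Sum>x\<in>S. fps_X ^ f x) k =
      fps_nth (Abs_fps (\<lambda>k. real (card {x \<in> S. f x = k}))) k" by simp
qed

lemma finite_class: "perm_class C \<Longrightarrow> finite {\<pi>. (n, \<pi>) \<in> C}"
  by (rule finite_subset[OF _ finite_permutations[of "{1..n}"]]) (auto simp: perm_class_def)

lemma perm_gf_nth:
  "perm_class C \<Longrightarrow> fps_nth (perm_gf C) n = (\<Sum>\<pi> | (n, \<pi>) \<in> C. fps_X ^ num_cycles n \<pi>)"
  by (subst sum_fps_X_power) (simp_all add: finite_class gf2_def num_perms_def)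

lemma reduced_perm_gf_nth:
  assumes "perm_class C"
  shows "fps_nth (reduced_perm_gf C) n =
    (\<Sum>\<pi> | (n, \<pi>) \<in> C. if arcs {1..n} \<pi> = {} then fps_X ^ num_cycles n \<pi> else 0)"
proof -
  have "reduced_perm n \<pi> \<longleftrightarrow> arcs {1..n} \<pi> = {}" if "(n, \<pi>) \<in> C" for \<pi>
    using that assms by (intro reduced_perm_iff) (auto simp: perm_class_def)
  then have "{\<pi>. (n, \<pi>) \<in> C \<and> reduced_perm n \<pi> \<and> num_cycles n \<pi> = k} =
      {\<pi> \<in> {\<pi> \<in> {\<pi>. (n, \<pi>) \<in> C}. arcs {1..n} \<pi> = {}}. num_cycles n \<pi> = k}" for k
    by auto
  then have "fps_nth (reduced_perm_gf C) n =
      (\<Sum>\<pi> \<in> {\<pi> \<in> {\<pi>. (n, \<pi>) \<in> C}. arcs {1..n} \<pi> = {}}. fps_X ^ num_cycles n \<pi>)"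
    using finite_class[OF assms]
    by (subst sum_fps_X_power) (simp_all add: gf2_def num_reduced_perms_def)
  then show ?thesis
    using finite_class[OF assms] by (subst (asm) sum.inter_filter) simp_all
qed

text \<open>Relabeling preserves the number of orbits, so the sum depends on \<open>K\<close> only
  through its size.\<close>

lemma on_set_sum:
  assumes "finite K" "perm_class C"
  shows "(\<Sum>\<sigma>\<in>on_set C K. fps_X ^ card (orbit \<sigma> ` K)) = fps_nth (perm_gf C) (card K)"
proof -
  let ?m = "card K" and ?f = "lab K"
  note bij = lab_bij[OF assms(1)]
  have inj: "inj_on ?f {1..?m}" and im: "?f ` {1..?m} = K"
    using bij by (auto simp: bij_betw_def)
  have p: "\<tau> permutes {1..?m}" if "(?m, \<tau>) \<in> C" for \<tau>
    using that assms(2) by (auto simp: perm_class_def)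
  have "inj_on (map_permutation {1..?m} ?f) {\<tau>. (?m, \<tau>) \<in> C}"
  proof (rule inj_on_inverseI)
    fix \<tau> assume "\<tau> \<in> {\<tau>. (?m, \<tau>) \<in> C}"
    then show "map_permutation K (inv_into {1..?m} ?f) (map_permutation {1..?m} ?f \<tau>) = \<tau>"
      using map_permutation_compose_inv[OF bij] p bij_betw_inv_into_left[OF bij] by simp
  qed
  then have "(\<Sum>\<sigma>\<in>on_set C K. fps_X ^ card (orbit \<sigma> ` K)) =
      (\<Sum>\<tau> | (?m, \<tau>) \<in> C. fps_X ^ card (orbit (map_permutation {1..?m} ?f \<tau>) ` K) :: real fps)"
    unfolding on_set_def by (simp add: sum.reindex)
  also have "\<dots> = (\<Sum>\<tau> | (?m, \<tau>) \<in> C. fps_X ^ num_cycles ?m \<tau>)"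
  proof (rule sum.cong)
    fix \<tau> assume "\<tau> \<in> {\<tau>. (?m, \<tau>) \<in> C}"
    then have \<tau>: "\<tau> permutes {1..?m}" using p by blast
    have "orbit (map_permutation {1..?m} ?f \<tau>) ` K =
        (\<lambda>i. orbit (map_permutation {1..?m} ?f \<tau>) (?f i)) ` {1..?m}"
      by (subst im[symmetric]) (simp only: image_image)
    also have "\<dots> = (\<lambda>i. ?f ` orbit \<tau> i) ` {1..?m}"
      using orbit_map_permutation[OF inj \<tau>] by (intro image_cong) auto
    also have "\<dots> = image ?f ` orbit \<tau> ` {1..?m}" by (simp only: image_image)
    finally have "orbit (map_permutation {1..?m} ?f \<tau>) ` K = image ?f ` orbit \<tau> ` {1..?m}" .
    moreover have "inj_on (image ?f) (orbit \<tau> ` {1..?m})"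
      using permutes_orbit_subset[OF \<tau>]
      by (intro inj_on_subset[OF inj_on_image_Pow[OF inj]]) blast
    ultimately show "fps_X ^ card (orbit (map_permutation {1..?m} ?f \<tau>) ` K) =
        (fps_X ^ num_cycles ?m \<tau> :: real fps)"
      by (simp add: num_cycles_def card_image)
  qed simp
  finally show ?thesis using perm_gf_nth[OF assms(2)] by simp
qed

text \<open>\<open>arc_perm\<close> fixes the kept points and \<sigma> fixes all others, so the
  composition glues the two permutations together. The conclusions say that \<open>K\<close>,
  \<open>E\<close> and \<sigma> can be recovered from \<pi> and \<open>S\<close>, and that cycles
  add up.\<close>

lemma config_perm:
  assumes "config n K E" "\<sigma> permutes K" "n \<ge> 1"
  defines "\<pi> \<equiv> \<sigma> \<circ> arc_perm n (K \<union> E)"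
  defines "S \<equiv> orbit \<pi> ` ({1..n} - K)"
  shows "\<pi> permutes {1..n}" "perm_restrict \<pi> K = \<sigma>" "S \<subseteq> arcs {1..n} \<pi>" "\<Union>S = {1..n} - K"
    and "{a \<in> {1..n} - K. \<pi> a \<noteq> nxt {1..n} a} = E"
    and "card S = (if K \<union> E = {} then 1 else card E)"
    and "num_cycles n \<pi> = card (orbit \<sigma> ` K) + card S"
proof -
  let ?b = "arc_perm n (K \<union> E)"
  note sets = config_sets[OF assms(1)]
  have fin: "finite {1..n}" by simp
  have KN: "K \<subseteq> {1..n}" using sets by blast
  show p: "\<pi> permutes {1..n}"
    unfolding \<pi>_def
    by (rule permutes_compose[OF arc_perm_permutes[OF sets(1)] permutes_subset[OF assms(2) KN]])
  have kept: "\<pi> k = \<sigma> k" if "k \<in> K" for k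
    using arc_perm_kept[OF assms(1) that] by (simp add: \<pi>_def)
  have removed: "\<pi> a = ?b a" if "a \<in> {1..n} - K" for a
    using arc_perm_removed[OF assms(1) that] permutes_not_in[OF assms(2)] by (simp add: \<pi>_def)
  show "perm_restrict \<pi> K = \<sigma>"
    using kept permutes_not_in[OF assms(2)] by (auto simp: perm_restrict_def)
  have orb_kept: "orbit \<pi> k = orbit \<sigma> k" if "k \<in> K" for k
    using kept permutes_in_image[OF assms(2)] that by (intro orbit_cong0[of k K]) auto
  have orb_removed: "orbit \<pi> a = orbit ?b a" if "a \<in> {1..n} - K" for a
    using orbit_cong0[of a "{1..n} - K" \<pi> ?b] removed arc_perm_removed[OF assms(1)] that by auto
  have sub: "orbit \<pi> a \<subseteq> {1..n} - K" if "a \<in> {1..n} - K" for a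
    using orbit_arc_perm_subset[OF assms(1) that] orb_removed[OF that] by simp
  show "S \<subseteq> arcs {1..n} \<pi>"
  proof
    fix B assume "B \<in> S"
    then obtain a where a: "a \<in> {1..n} - K" "B = orbit \<pi> a" by (auto simp: S_def)
    have B: "B = orbit ?b a" using a orb_removed by simp
    obtain e where "e \<in> B" "\<forall>x\<in>B - {e}. ?b x = nxt {1..n} x"
      using orbit_arc_perm_is_arc[OF assms(1) a(1)] unfolding B by blast
    moreover have "\<pi> x = ?b x" if "x \<in> B" for x
      using removed sub[OF a(1)] a(2) that by blast
    ultimately have "\<exists>e\<in>B. \<forall>x\<in>B - {e}. \<pi> x = nxt {1..n} x" by auto
    then show "B \<in> arcs {1..n} \<pi>" using a by (auto simp: arcs_def)
  qed
  show "\<Union>S = {1..n} - K"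
  proof (intro equalityI subsetI)
    fix x assume "x \<in> \<Union>S"
    then obtain a where "a \<in> {1..n} - K" "x \<in> orbit \<pi> a" by (auto simp: S_def)
    then show "x \<in> {1..n} - K" using sub by blast
  next
    fix x assume "x \<in> {1..n} - K"
    then show "x \<in> \<Union>S" using permutes_self_in_orbit[OF p fin, of x] by (auto simp: S_def)
  qed
  have "{a \<in> {1..n} - K. \<pi> a \<noteq> nxt {1..n} a} = {a \<in> {1..n} - K. ?b a \<noteq> nxt {1..n} a}"
    using removed by auto
  then show "{a \<in> {1..n} - K. \<pi> a \<noteq> nxt {1..n} a} = E"
    using arc_perm_ends[OF assms(1)] by simp
  have "S = orbit ?b ` ({1..n} - K)"
    unfolding S_def using orb_removed by (intro image_cong) auto
  then show "card S = (if K \<union> E = {} then 1 else card E)"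
    using card_orbits_arc_perm[OF assms(1,3)] by simp
  have "orbit \<pi> ` {1..n} = orbit \<pi> ` K \<union> S"
    unfolding S_def using KN by blast
  moreover have "orbit \<pi> ` K = orbit \<sigma> ` K" using orb_kept by (intro image_cong) auto
  moreover have "orbit \<sigma> ` K \<inter> S = {}"
  proof -
    have False if B: "B \<in> orbit \<sigma> ` K" "B \<in> S" for B
    proof -
      obtain k where k: "k \<in> K" "B = orbit \<sigma> k" using B(1) by blast
      obtain a where a: "a \<in> {1..n} - K" "B = orbit \<pi> a" using B(2) by (auto simp: S_def)
      have "\<sigma> k \<in> B" unfolding k(2) by (rule orbit.base)
      moreover have "B \<subseteq> K" unfolding k(2) by (rule permutes_orbit_subset[OF assms(2) k(1)])
      moreover have "B \<subseteq> {1..n} - K" unfolding a(2) by (rule sub[OF a(1)])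
      ultimately show False by (metis DiffD2 subsetD)
    qed
    then show ?thesis by (metis disjoint_iff)
  qed
  moreover have "finite K" "finite S" using KN finite_subset by (auto simp: S_def)
  ultimately show "num_cycles n \<pi> = card (orbit \<sigma> ` K) + card S"
    by (simp add: num_cycles_def card_Un_disjoint)
qed

text \<open>The sign and the variable \<open>y\<close> for every chosen arc. The exponent is the
  number of arcs; the full circle counts as one arc although it has no end.\<close>

definition config_wt :: "nat set \<Rightarrow> nat set \<Rightarrow> real fps" where
  "config_wt K E = (- fps_X) ^ (if K \<union> E = {} then 1 else card E)"

lemma finite_config [simp]: "finite {E. config n K E}"
  by (rule finite_subset[of _ "Pow {1..n}"]) (auto simp: config_def)

lemma reduced_sum:
  assumes "perm_class C" "closed_under_trivial_reductions C" "closed_under_trivial_extensions C"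
    and n: "n \<ge> 1"
  shows "fps_nth (reduced_perm_gf C) n =
    (\<Sum>K\<in>Pow {1..n}. (\<Sum>E | config n K E. config_wt K E) * fps_nth (perm_gf C) (card K))"
proof -
  let ?N = "{1..n}"
  define I where "I = (SIGMA \<pi>:{\<pi>. (n, \<pi>) \<in> C}. Pow (arcs ?N \<pi>))"
  define J where "J = (SIGMA K:Pow ?N. SIGMA E:{E. config n K E}. on_set C K)"
  define i where "i = (\<lambda>(K, E, \<sigma>). (\<sigma> \<circ> arc_perm n (K \<union> E), orbit (\<sigma> \<circ> arc_perm n (K \<union> E)) ` (?N - K)))"
  define j where "j = (\<lambda>(\<pi> :: nat \<Rightarrow> nat, S). let K = ?N - \<Union>S in
    (K, {a \<in> ?N - K. \<pi> a \<noteq> nxt ?N a}, perm_restrict \<pi> K))"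
  have fin: "finite ?N" by simp
  have permC: "\<pi> permutes ?N" if "(n, \<pi>) \<in> C" for \<pi>
    using that assms(1) by (auto simp: perm_class_def)
  have CI: "(n, \<pi>) \<in> C \<longleftrightarrow> \<pi> \<in> on_set C ?N" for \<pi>
    using on_set_Icc[OF assms(1)] by simp
  \<comment> \<open>The alternating sum over all sets of arcs is 1 if there is no arc and 0
    otherwise.\<close>
  have "fps_nth (reduced_perm_gf C) n =
      (\<Sum>\<pi> | (n, \<pi>) \<in> C. \<Sum>S\<in>Pow (arcs ?N \<pi>). (- 1) ^ card S * fps_X ^ num_cycles n \<pi>)"
    unfolding reduced_perm_gf_nth[OF assms(1)] sum_distrib_right[symmetric]
    by (subst alternating_sum_Pow) (auto simp: finite_arcs intro!: sum.cong)
  also have "\<dots> = (\<Sum>(\<pi>, S)\<in>I. (- 1) ^ card S * fps_X ^ num_cycles n \<pi>)"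
    unfolding I_def by (rule sum.Sigma) (simp_all add: finite_class assms(1) finite_arcs)
  also have "\<dots> = (\<Sum>(K, E, \<sigma>)\<in>J. config_wt K E * fps_X ^ card (orbit \<sigma> ` K))"
  proof (rule sum.reindex_bij_witness[of _ i j])
    fix x assume x: "x \<in> I"
    obtain \<pi> S where xe: "x = (\<pi>, S)" by (cases x)
    have \<pi>: "(n, \<pi>) \<in> C" "\<pi> permutes ?N" "S \<subseteq> arcs ?N \<pi>"
      using x permC by (auto simp: xe I_def)
    define K where "K = ?N - \<Union>S"
    define E where "E = {a \<in> ?N - K. \<pi> a \<noteq> nxt ?N a}"
    have jx: "j x = (K, E, perm_restrict \<pi> K)"
      by (simp add: j_def xe Let_def K_def E_def)
    have config: "config n K E" by (rule arcs_config[OF \<pi>(2,3) K_def E_def])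
    have p: "perm_restrict \<pi> K permutes K"
      unfolding K_def by (rule remove_arcs_permutes(2)[OF \<pi>(2) fin \<pi>(3)])
    have U: "\<Union>S = ?N - K" using arcs_subset[OF \<pi>(2)] \<pi>(3) unfolding K_def by blast
    have eq: "perm_restrict \<pi> K \<circ> arc_perm n (K \<union> E) = \<pi>"
    proof
      fix a
      consider "a \<in> K" | "a \<in> ?N - K" | "a \<notin> ?N" using K_def by blast
      then show "(perm_restrict \<pi> K \<circ> arc_perm n (K \<union> E)) a = \<pi> a"
      proof cases
        case 1
        then show ?thesis using arc_perm_kept[OF config 1] by (simp add: perm_restrict_def)
      next
        case 2
        then show ?thesis
          using arc_perm_removed[OF config 2] arcs_determine[OF \<pi>(2,3) K_def E_def 2]
          by (simp add: perm_restrict_def)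
      next
        case 3
        then have "a \<notin> K" by (auto simp: K_def)
        then show ?thesis
          using permutes_not_in[OF arc_perm_permutes[OF config_sets(1)[OF config]] 3]
            permutes_not_in[OF \<pi>(2) 3] by (simp add: perm_restrict_def)
      qed
    qed
    have S: "orbit \<pi> ` (?N - K) = S"
    proof (intro equalityI subsetI)
      fix B assume "B \<in> orbit \<pi> ` (?N - K)"
      then obtain a where a: "a \<in> \<Union>S" "B = orbit \<pi> a" using U by auto
      then obtain B' where "B' \<in> S" "a \<in> B'" by blast
      then show "B \<in> S" using arcs_eq_orbit[OF \<pi>(2) fin, of B' a] \<pi>(3) a by auto
    next
      fix B assume B: "B \<in> S"
      then have Ba: "B \<in> arcs ?N \<pi>" using \<pi>(3) by blast
      then obtain a where a: "a \<in> B" by (auto simp: arcs_def)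
      then have "a \<in> ?N - K" using U B by blast
      then show "B \<in> orbit \<pi> ` (?N - K)" using arcs_eq_orbit[OF \<pi>(2) fin Ba a] by blast
    qed
    show "i (j x) = x" unfolding jx unfolding i_def prod.case eq S xe ..
    have "perm_restrict \<pi> K \<in> on_set C K"
      using on_set_remove_arcs[OF assms(1-3) fin \<pi>(2,3)] \<pi>(1) CI unfolding K_def by simp
    then show "j x \<in> J" using config by (auto simp: jx J_def config_def)
    have "num_cycles n \<pi> = card (orbit (perm_restrict \<pi> K) ` K) + card S"
      "card S = (if K \<union> E = {} then 1 else card E)"
      using config_perm(6,7)[OF config p n] unfolding eq S by simp_all
    then show "(case j x of (K, E, \<sigma>) \<Rightarrow> config_wt K E * fps_X ^ card (orbit \<sigma> ` K)) =
        (case x of (\<pi>, S) \<Rightarrow> (- 1) ^ card S * fps_X ^ num_cycles n \<pi>)"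
      unfolding jx unfolding xe prod.case config_wt_def
      by (simp only: power_add) (simp add: power_minus[of fps_X] mult_ac)
  next
    fix y assume y: "y \<in> J"
    obtain K E \<sigma> where ye: "y = (K, E, \<sigma>)" by (metis prod.exhaust)
    have config: "config n K E" and \<sigma>C: "\<sigma> \<in> on_set C K" and K: "K \<subseteq> ?N"
      using y by (auto simp: ye J_def)
    have \<sigma>: "\<sigma> permutes K"
      using on_set_permutes[OF finite_subset[OF K fin] assms(1) \<sigma>C] .
    define \<pi> where "\<pi> = \<sigma> \<circ> arc_perm n (K \<union> E)"
    note cp = config_perm[OF config \<sigma> n, folded \<pi>_def]
    have iy: "i y = (\<pi>, orbit \<pi> ` (?N - K))" by (simp add: i_def ye \<pi>_def)
    have K': "?N - \<Union>(orbit \<pi> ` (?N - K)) = K" using cp(4) K by auto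
    show "j (i y) = y"
      unfolding iy unfolding j_def prod.case Let_def K' cp(2,5) unfolding ye ..
    have "(n, \<pi>) \<in> C"
      using on_set_remove_arcs[OF assms(1-3) fin cp(1,3)] \<sigma>C unfolding K' cp(2) CI by simp
    then show "i y \<in> I" using cp(3) by (simp add: iy I_def)
  qed
  also have "\<dots> = (\<Sum>K\<in>Pow ?N. \<Sum>E | config n K E. \<Sum>\<sigma>\<in>on_set C K.
      config_wt K E * fps_X ^ card (orbit \<sigma> ` K))"
  proof -
    have fK: "finite (on_set C K)" if "K \<in> Pow ?N" for K
      using that by (intro finite_on_set assms(1)) (auto intro: finite_subset)
    have "(\<Sum>E | config n K E. \<Sum>\<sigma>\<in>on_set C K. config_wt K E * fps_X ^ card (orbit \<sigma> ` K)) =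
        (\<Sum>(E, \<sigma>)\<in>(SIGMA E:{E. config n K E}. on_set C K).
          config_wt K E * fps_X ^ card (orbit \<sigma> ` K))" if "K \<in> Pow ?N" for K
      using fK[OF that] by (intro sum.Sigma) auto
    then have "(\<Sum>K\<in>Pow ?N. \<Sum>E | config n K E. \<Sum>\<sigma>\<in>on_set C K.
          config_wt K E * fps_X ^ card (orbit \<sigma> ` K)) =
        (\<Sum>K\<in>Pow ?N. \<Sum>(E, \<sigma>)\<in>(SIGMA E:{E. config n K E}. on_set C K).
          config_wt K E * fps_X ^ card (orbit \<sigma> ` K))"
      by (intro sum.cong refl)
    also have "\<dots> = (\<Sum>(K, E, \<sigma>)\<in>J. config_wt K E * fps_X ^ card (orbit \<sigma> ` K))"
      unfolding J_def using fK by (intro sum.Sigma) auto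
    finally show ?thesis ..
  qed
  also have "\<dots> = (\<Sum>K\<in>Pow ?N. (\<Sum>E | config n K E. config_wt K E) * fps_nth (perm_gf C) (card K))"
  proof (rule sum.cong)
    fix K assume "K \<in> Pow ?N"
    then have "finite K" using fin finite_subset by blast
    then show "(\<Sum>E | config n K E. \<Sum>\<sigma>\<in>on_set C K. config_wt K E * fps_X ^ card (orbit \<sigma> ` K)) =
        (\<Sum>E | config n K E. config_wt K E) * fps_nth (perm_gf C) (card K)"
      by (simp only: on_set_sum[OF _ assms(1), symmetric] sum_distrib_left[symmetric] sum_distrib_right)
  qed simp
  finally show ?thesis .
qed

text \<open>Expansion of the product: a removed point is an end with weight \<open>- y\<close>, or
  it is not, with weight \<open>?g\<close>. The latter is 0 in front of a kept point, where an end
  is forced.\<close>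

lemma config_sum_kept:
  assumes "K \<subseteq> {1..n}" "K \<noteq> {}"
  shows "(\<Sum>E | config n K E. config_wt K E) = wt n K"
proof -
  let ?V = "{1..n} - K"
  let ?g = "\<lambda>a. if nxt {1..n} a \<in> K then 0 else 1 :: real fps"
  have "wt n K = (\<Prod>a\<in>?V. - fps_X + ?g a)"
    unfolding wt_def by (intro prod.cong) auto
  also have "\<dots> = (\<Sum>E\<in>Pow ?V. (\<Prod>a\<in>E. - fps_X) * prod ?g (?V - E))"
    by (rule prod_add) simp
  also have "\<dots> = (\<Sum>E\<in>Pow ?V. if \<forall>a\<in>?V. nxt {1..n} a \<in> K \<longrightarrow> a \<in> E then (- fps_X) ^ card E else 0)"
  proof (rule sum.cong)
    fix E
    show "(\<Prod>a\<in>E. - fps_X) * prod ?g (?V - E) =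
        (if \<forall>a\<in>?V. nxt {1..n} a \<in> K \<longrightarrow> a \<in> E then (- fps_X) ^ card E else 0)"
    proof (cases "\<forall>a\<in>?V. nxt {1..n} a \<in> K \<longrightarrow> a \<in> E")
      case True
      then have "prod ?g (?V - E) = 1" by (intro prod.neutral) auto
      then show ?thesis using True by simp
    next
      case False
      then obtain a where "a \<in> ?V - E" "nxt {1..n} a \<in> K" by blast
      then have "prod ?g (?V - E) = 0" by (intro prod_zero) auto
      then show ?thesis by (simp only: if_not_P[OF False] mult_zero_right)
    qed
  qed simp
  also have "\<dots> = (\<Sum>E | E \<in> Pow ?V \<and> (\<forall>a\<in>?V. nxt {1..n} a \<in> K \<longrightarrow> a \<in> E). (- fps_X) ^ card E)"
    by (rule sum.inter_filter[symmetric]) simp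
  also have "\<dots> = (\<Sum>E | config n K E. config_wt K E)"
    using assms by (intro sum.cong) (auto simp: config_def config_wt_def)
  finally show ?thesis ..
qed

text \<open>Free ends give \<open>(1 - y)^n\<close>. The \<open>n\<close> singletons, of total
  weight \<open>- n y\<close>, drop out, and the empty set changes its weight from 1 to
  \<open>- y\<close>, as it stands for the single full arc.\<close>

lemma config_sum_empty:
  assumes "n \<ge> 1"
  shows "(\<Sum>E | config n {} E. config_wt {} E) = empty_coeff n"
proof -
  let ?A = "{E. E \<subseteq> {1..n} \<and> card E = 1}" and ?B = "{E. E \<subseteq> {1..n} \<and> card E \<noteq> 1}"
  let ?p = "\<lambda>E. (- fps_X :: real fps) ^ card E"
  have "(\<Sum>E\<in>Pow {1..n}. ?p E) = (\<Prod>a\<in>{1..n}. - fps_X + 1)"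
    by (subst prod_add) simp_all
  also have "\<dots> = (1 - fps_X) ^ n" by (simp add: prod_constant)
  finally have all: "(\<Sum>E\<in>Pow {1..n}. ?p E) = (1 - fps_X) ^ n" .
  have "Pow {1..n} = ?A \<union> ?B" by auto
  then have "(\<Sum>E\<in>Pow {1..n}. ?p E) = (\<Sum>E\<in>?A. ?p E) + (\<Sum>E\<in>?B. ?p E)"
    by (simp only:) (rule sum.union_disjoint; auto)
  moreover have "(\<Sum>E\<in>?A. ?p E) = - (of_nat n * fps_X)"
    using n_subsets[of "{1..n}" 1] by (simp add: choose_one)
  moreover have B: "(\<Sum>E\<in>?B. f E) = f {} + (\<Sum>E\<in>?B - {{}}. f E)" for f :: "nat set \<Rightarrow> real fps"
    by (rule sum.remove) auto
  moreover have "(\<Sum>E\<in>?B - {{}}. config_wt {} E) = (\<Sum>E\<in>?B - {{}}. ?p E)"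
    by (intro sum.cong) (auto simp: config_wt_def)
  moreover have "{E. config n {} E} = ?B" by (auto simp: config_def)
  ultimately show ?thesis
    using assms all B[of "config_wt {}"] by (simp add: empty_coeff_def config_wt_def algebra_simps)
qed

lemma reduced_coeff:
  assumes "perm_class C" "closed_under_trivial_reductions C" "closed_under_trivial_extensions C"
    and n: "n \<ge> 1"
  shows "fps_nth (reduced_perm_gf C) n = empty_coeff n * fps_nth (perm_gf C) 0 +
    (\<Sum>m=1..n. wt_sum n m * fps_nth (perm_gf C) m)"
proof -
  let ?P = "\<lambda>m. fps_nth (perm_gf C) m"
  let ?f = "\<lambda>K. (\<Sum>E | config n K E. config_wt K E) * ?P (card K)"
  have "(\<Sum>K\<in>Pow {1..n}. ?f K) = ?f {} + (\<Sum>K\<in>Pow {1..n} - {{}}. ?f K)"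
    by (rule sum.remove) auto
  also have "?f {} = empty_coeff n * ?P 0" by (simp add: config_sum_empty[OF n])
  also have "(\<Sum>K\<in>Pow {1..n} - {{}}. ?f K) = (\<Sum>K\<in>Pow {1..n} - {{}}. wt n K * ?P (card K))"
    by (intro sum.cong) (auto simp: config_sum_kept)
  also have "\<dots> = (\<Sum>m\<in>{1..n}. \<Sum>K | K \<in> Pow {1..n} - {{}} \<and> card K = m. wt n K * ?P (card K))"
  proof (rule sum.group[symmetric])
    show "card ` (Pow {1..n} - {{}}) \<subseteq> {1..n}"
    proof
      fix m assume "m \<in> card ` (Pow {1..n} - {{}})"
      then obtain K where K: "m = card K" "K \<subseteq> {1..n}" "K \<noteq> {}" by blast
      then have "card K > 0" "card K \<le> card {1..n}"
        using finite_subset[OF K(2)] card_mono[OF _ K(2)] by (auto simp: card_gt_0_iff)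
      then show "m \<in> {1..n}" using K by simp
    qed
  qed auto
  also have "\<dots> = (\<Sum>m=1..n. wt_sum n m * ?P m)"
  proof (rule sum.cong)
    fix m assume "m \<in> {1..n}"
    then have "{K. K \<in> Pow {1..n} - {{}} \<and> card K = m} = {K. K \<subseteq> {1..n} \<and> card K = m}" by auto
    then show "(\<Sum>K | K \<in> Pow {1..n} - {{}} \<and> card K = m. wt n K * ?P (card K)) = wt_sum n m * ?P m"
      by (simp add: wt_sum_def sum_distrib_right)
  qed simp
  finally show ?thesis unfolding reduced_sum[OF assms] .
qed

section \<open>Assembling the generating functions\<close>

lemma nth_X_deriv: "fps_nth (X * fps_deriv f) n = of_nat n * fps_nth f n"
  by (cases n) (simp_all add: Suc_eq_plus1 add.commute)

text \<open>\<open>T\<close> is \<open>R\<close> without its constant term and without the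
  contribution of \<open>K = {}\<close>. With the coefficients \<open>P_m / m\<close> in
  \<open>H\<close>, the rotation factor \<open>n / m\<close> makes \<open>T\<close> equal to
  \<open>x\<close> times the derivative of \<open>H\<close> composed with
  \<open>phi\<close>.\<close>

lemma reduced_gf_eq:
  assumes "perm_class C" "closed_under_trivial_reductions C" "closed_under_trivial_extensions C"
  defines "P \<equiv> perm_gf C" and "R \<equiv> reduced_perm_gf C"
  defines "T \<equiv> R - fps_const (fps_nth R 0) - fps_const (fps_nth P 0) * empty_gf"
  shows "phi * T = X * fps_deriv phi * ((P - fps_const (fps_nth P 0)) oo phi)"
proof -
  define c where "c m = (fps_const (1 / real m) :: real fps)" for m
  have c: "c m * of_nat m = 1" if "m \<ge> 1" for m
    using that by (simp add: c_def fps_of_nat[symmetric])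
  define H where "H = Abs_fps (\<lambda>m. if m = 0 then 0 else c m * fps_nth P m)"
  have XH: "X * fps_deriv H = P - fps_const (fps_nth P 0)"
  proof (rule fps_ext)
    fix n
    show "fps_nth (X * fps_deriv H) n = fps_nth (P - fps_const (fps_nth P 0)) n"
    proof (cases n)
      case (Suc k)
      have "fps_nth (X * fps_deriv H) n = of_nat n * (c n * fps_nth P n)"
        unfolding nth_X_deriv using Suc by (simp add: H_def)
      also have "\<dots> = (c n * of_nat n) * fps_nth P n" by (simp only: ac_simps)
      also have "\<dots> = fps_nth P n" using Suc by (subst c) auto
      finally show ?thesis using Suc by simp
    qed simp
  qed
  have "T = X * fps_deriv (H oo phi)"
  proof (rule fps_ext)
    fix n
    show "fps_nth T n = fps_nth (X * fps_deriv (H oo phi)) n"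
    proof (cases "n = 0")
      case True
      then show ?thesis by (simp add: T_def empty_gf_def empty_coeff_def)
    next
      case False
      then have n: "n \<ge> 1" by simp
      have "fps_nth T n = (\<Sum>m=1..n. wt_sum n m * fps_nth P m)"
        using reduced_coeff[OF assms(1-3) n] False
        by (simp add: T_def P_def R_def empty_gf_def mult.commute)
      also have "\<dots> = (\<Sum>m=1..n. of_nat n * (fps_nth H m * fps_nth (phi ^ m) n))"
      proof (rule sum.cong)
        fix m assume "m \<in> {1..n}"
        then have m: "m \<ge> 1" by simp
        have "wt_sum n m * fps_nth P m = (c m * of_nat m) * wt_sum n m * fps_nth P m"
          by (simp add: c[OF m])
        also have "\<dots> = c m * (of_nat m * wt_sum n m) * fps_nth P m"
          by (simp only: ac_simps)
        also have "\<dots> = of_nat n * (c m * fps_nth P m * kept_sum n m)"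
          unfolding wt_sum_kept[OF n] by (simp only: ac_simps)
        finally show "wt_sum n m * fps_nth P m = of_nat n * (fps_nth H m * fps_nth (phi ^ m) n)"
          using m by (simp add: H_def kept_sum_eq_power)
      qed simp
      also have "\<dots> = of_nat n * (\<Sum>m=0..n. fps_nth H m * fps_nth (phi ^ m) n)"
        by (simp add: sum_distrib_left[symmetric] sum.atLeast_Suc_atMost[of 0] H_def One_nat_def)
      also have "\<dots> = fps_nth (X * fps_deriv (H oo phi)) n"
        by (simp only: nth_X_deriv fps_compose_nth)
      finally show ?thesis .
    qed
  qed
  also have "\<dots> = X * ((fps_deriv H oo phi) * fps_deriv phi)"
    by (simp add: fps_compose_deriv)
  \<comment> \<open>The extra factor \<open>phi\<close> completes the derivative of \<open>H\<close>
    to \<open>x H'\<close> before composition, and this is \<open>P\<close> without its constant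
    term.\<close>
  finally have "phi * T = X * fps_deriv phi * (phi * (fps_deriv H oo phi))"
    by (simp only: ac_simps)
  also have "phi * (fps_deriv H oo phi) = (X * fps_deriv H) oo phi"
    by (simp add: fps_compose_mult_distrib)
  finally show ?thesis unfolding XH .
qed

lemma gf_nth_0:
  assumes "perm_class C"
  shows "fps_nth (perm_gf C) 0 = (if (0, id) \<in> C then 1 else 0)"
    and "fps_nth (reduced_perm_gf C) 0 = (if (0, id) \<in> C then 1 else 0)"
proof -
  have "\<pi> = id" if "(0, \<pi>) \<in> C" for \<pi>
    using that assms by (auto simp: perm_class_def)
  then have "{\<pi>. (0, \<pi>) \<in> C} = (if (0, id) \<in> C then {id} else {})" by auto
  then show "fps_nth (perm_gf C) 0 = (if (0, id) \<in> C then 1 else 0)"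
    and "fps_nth (reduced_perm_gf C) 0 = (if (0, id) \<in> C then 1 else 0)"
    unfolding perm_gf_nth[OF assms] reduced_perm_gf_nth[OF assms]
    by (simp_all add: num_cycles_def arcs_def)
qed

theorem theorem5p3:
  fixes C :: "sized_perm set"
  assumes "perm_class C"
    and "closed_under_trivial_reductions C"
    and "closed_under_trivial_extensions C"
  defines "P \<equiv> perm_gf C"
    and "R \<equiv> reduced_perm_gf C"
    and "D \<equiv> nc_gf"
  shows "((0, id) \<notin> C \<longrightarrow>
            P = (R oo (X * D)) * (1 + X * (fps_deriv D / D))) \<and>
         ((0, id) \<in> C \<longrightarrow>
            P = ((R - 1) oo (X * D)) * (1 + X * (fps_deriv D / D)) + D) \<and>
         D = (1 - X - X * Y - fps_sqrt ((X + X * Y - 1)\<^sup>2 - 4 * X\<^sup>2 * Y)) / (2 * X) + 1"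
proof (intro conjI impI)
  let ?L = "1 + X * (fps_deriv D / D)"
  let ?T = "R - fps_const (fps_nth R 0) - fps_const (fps_nth P 0) * empty_gf"
  have main: "P - fps_const (fps_nth P 0) = (?T oo (X * D)) * ?L"
    unfolding P_def R_def D_def by (rule invert_substitution[OF reduced_gf_eq[OF assms(1-3)]])
  \<comment> \<open>Both constant terms vanish, and with them the term in
    \<open>empty_gf\<close>.\<close>
  show "P = (R oo (X * D)) * ?L" if "(0, id) \<notin> C"
    using main that gf_nth_0[OF assms(1)] by (simp add: P_def R_def)
  show "P = ((R - 1) oo (X * D)) * ?L + D" if "(0, id) \<in> C"
  proof -
    have "P - 1 = ((R - 1 - empty_gf) oo (X * D)) * ?L"
      using main that gf_nth_0[OF assms(1)] by (simp add: P_def R_def)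
    also have "\<dots> = ((R - 1) oo (X * D)) * ?L - (empty_gf oo (X * D)) * ?L"
      by (simp only: fps_compose_sub_distrib left_diff_distrib)
    \<comment> \<open>Moving \<open>1 - D\<close> to the other side replaces the empty permutation,
      counted by 1, by everything that reduces to it.\<close>
    also have "(empty_gf oo (X * D)) * ?L = 1 - D"
      unfolding D_def by (rule empty_gf_invert)
    finally show ?thesis by (simp add: algebra_simps)
  qed
  show "D = (1 - X - X * Y - fps_sqrt ((X + X * Y - 1)\<^sup>2 - 4 * X\<^sup>2 * Y)) / (2 * X) + 1"
    unfolding D_def by (rule nc_gf_closed_form)
qed

end
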